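(* Let $k_0\in\mathbb{N}$ be an arbitrary fixed number and let $l=l(T)>0$ satisfy $l=o\left(\frac{T}{\ln T}\right)$ as $T\to\infty$. For every fixed $L_2$-orthogonal system $\{f_n(t)\}_{n=1}^\infty$, $t\in[0,2l]$ (real-valued functions), that is, with $$\int_0^{2l} f_m(t)f_n(t)\,dt=\begin{cases}0, & m\neq n,\\ A_n, & m=n,\end{cases}\qquad A_n=\int_0^{2l} f_n^2(t)\,dt,$$ there is a continuum set (parametrized by all sufficiently large $T$, and by $k=1,\dots,k_0$) of $L_2$-orthogonal systems $$\{F_n(t;T,k,l)\}_{n=1}^\infty=\left\{ f_n\big(\varphi_1^k(t)-T\big)\prod_{r=0}^{k-1}\left|\tilde Z[\varphi_1^r(t)]\right|\right\}_{n=1}^\infty,\qquad t\in[T^{(k)},(T+2l)^{(k)}],$$ i.e. for all sufficiently large $T$, all $k=1,\dots,k_0$ and all $m,n\ge 1$, $$\int_{T^{(k)}}^{(T+2l)^{(k)}} f_m\big(\varphi_1^k(t)-T\big)f_n\big(\varphi_1^k(t)-T\big)\prod_{r=0}^{k-1}\tilde Z^2[\varphi_1^r(t)]\,dt=\begin{cases}0, & m\neq n,\\ A_n, & m=n.\end{cases}$$ Moreover, as $T\to\infty$, for $k=1,\dots,k_0$: (i) $(T+2l)^{(k)}-T^{(k)}=o\left(\frac{T}{\ln T}\right)$; (ii) $T^{(k)}-(T+2l)^{(k-1)}\sim(1-c)\,\pi(T)$, where $\pi(T)\sim\frac{T}{\ln T}$; (iii) $[T,T+2l]\prec[T^{(1)},(T+2l)^{(1)}]\prec\dots\prec[T^{(k_0)},(T+2l)^{(k_0)}]$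 (for all sufficiently large $T$).
   Context: Let $Z(t)=e^{i\vartheta(t)}\zeta\left(\frac12+it\right)$ with $\vartheta(t)=-\frac t2\ln\pi+\operatorname{Im}\ln\Gamma\left(\frac14+i\frac t2\right)$, where $\zeta$ is the Riemann zeta-function. Jacob's ladder: $\varphi_1(t)=\frac12\varphi(t)$, where $y=\varphi(T)=\varphi_\mu(T)$ is the solution $x(T)$ of the nonlinear integral equation $$\int_0^{\mu[x(T)]}Z^2(t)e^{-\frac{2}{x(T)}t}\,dt=\int_0^T Z^2(t)\,dt,$$ generated by a fixed admissible function $\mu$, with $\mu(y)\ge 7y\ln y$. Known properties of $\varphi_1$ taken as standing facts: for large $t$ it is increasing, with $\varphi_1(t)\to\infty$ as $t\to\infty$, and $T-\varphi_1(T)\sim(1-c)\pi(T)$ as $T\to\infty$; here $c$ is Euler's constant and $\pi$ is the prime-counting function. The function $\tilde Z$ is given by $$\tilde Z^2(t)=\frac{d\varphi_1(t)}{dt}=\frac{\left|\zeta\left(\frac12+it\right)\right|^2}{\omega(t)},\qquad \omega(t)=\left\{1+O\left(\frac{\ln\ln t}{\ln t}\right)\right\}\ln t .$$ Iterations: $\varphi_1^0(t)=t$, $\varphi_1^1(t)=\varphi_1(t)$, $\varphi_1^2(t)=\varphi_1(\varphi_1(t))$, and so on. Reverse iterations: for large $X$ put $X^{(0)}=X$ and define $X^{(k)}$ by $\varphi_1(X^{(k)})=X^{(k-1)}$, $k=1,\dots,k_0$, i.e. $X^{(k)}=\varphi_1^{-k}(X)$. Thus $\varphi_1$ maps $[T^{(k)},(T+2l)^{(k)}]$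 onto $[T^{(k-1)},(T+2l)^{(k-1)}]$. For intervals, $[a,b]\prec[a',b']$ means that $[a,b]$ lies entirely to the left of $[a',b']$, i.e. $b<a'$. *)

theory Defs
  imports
    "HOL-Complex_Analysis.Complex_Analysis"
    "HOL-Library.Landau_Symbols"
    "HOL-Computational_Algebra.Primes"
begin

(* The analytic continuation of the Dirichlet series; only the value at the pole s = 1
   is left unspecified. *)
definition riemann_zeta :: "complex \<Rightarrow> complex" where
  "riemann_zeta = (SOME f. f holomorphic_on (- {1}) \<and>
     (\<forall>s. Re s > 1 \<longrightarrow> (\<lambda>n. 1 / of_nat (Suc n) powr s) sums f s))"

(* ln_Gamma is the branch of the logarithm of Gamma that is real on the positive reals
   and analytic off the nonpositive real axis, as is usual in this definition. *)
definition rs_theta :: "real \<Rightarrow> real" where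
  "rs_theta t = - (t / 2) * ln pi + Im (ln_Gamma (Complex (1/4) (t / 2)))"

definition hardy_Z :: "real \<Rightarrow> complex" where
  "hardy_Z t = exp (\<i> * of_real (rs_theta t)) * riemann_zeta (Complex (1/2) t)"

definition prime_pi :: "real \<Rightarrow> real" where
  "prime_pi x = real (card {p::nat. prime p \<and> real p \<le> x})"

(* X^(k). The function phi_1 is only known to be increasing on some half-line [t0, oo), so
   the inverse is taken there. For large X the result does not depend on t0. *)
definition rev_iter :: "real \<Rightarrow> (real \<Rightarrow> real) \<Rightarrow> nat \<Rightarrow> real \<Rightarrow> real" where
  "rev_iter t0 \<phi>1 k X = ((inv_into {t0..} \<phi>1) ^^ k) X"

definition L2_on :: "real set \<Rightarrow> (real \<Rightarrow> real) \<Rightarrow> bool" where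
  "L2_on S f \<longleftrightarrow> f \<in> borel_measurable (lebesgue_on S) \<and>
     integrable (lebesgue_on S) (\<lambda>t. (f t)\<^sup>2)"

(* Systems are indexed by n = 1, 2, ...; the value at n = 0 is irrelevant. *)
definition L2_orthogonal_system ::
    "real set \<Rightarrow> (nat \<Rightarrow> real) \<Rightarrow> (nat \<Rightarrow> real \<Rightarrow> real) \<Rightarrow> bool" where
  "L2_orthogonal_system S A f \<longleftrightarrow>
     (\<forall>n\<ge>1. L2_on S (f n)) \<and>
     (\<forall>m\<ge>1. \<forall>n\<ge>1.
        (LINT t|lebesgue_on S. f m t * f n t) = (if m = n then A n else 0))"

definition ladder_system ::
    "(real \<Rightarrow> real) \<Rightarrow> (real \<Rightarrow> real) \<Rightarrow> (nat \<Rightarrow> real \<Rightarrow> real) \<Rightarrow> real \<Rightarrow> nat \<Rightarrow> nat \<Rightarrow> real \<Rightarrow> real" where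
  "ladder_system \<phi>1 Zt f T k n t =
     f n ((\<phi>1 ^^ k) t - T) * (\<Prod>r<k. \<bar>Zt ((\<phi>1 ^^ r) t)\<bar>)"

(* [a,b] precedes [a',b']; both are required to be genuine intervals. *)
definition ivl_prec :: "real \<times> real \<Rightarrow> real \<times> real \<Rightarrow> bool" where
  "ivl_prec I J \<longleftrightarrow> fst I \<le> snd I \<and> snd I < fst J \<and> fst J \<le> snd J"

end

theory Submission
  imports Defs "HOL-Number_Theory.Prime_Powers" "HOL-Real_Asymp.Real_Asymp"
begin

text \<open>
  Let \<open>g\<close> be the inverse of \<open>\<phi>\<^sub>1\<close> and \<open>c\<close> Euler's constant. The hypothesis on \<open>T - \<phi>\<^sub>1(T)\<close>
  gives \<open>g(X) - X \<sim> (1 - c) X / ln X\<close>, so that two points at distance \<open>o(T / ln T)\<close> near \<open>T\<close> are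
  moved by \<open>g\<close> by the same amount up to \<open>o(T / ln T)\<close>; iterating this yields (i), (ii) and (iii).
  Orthogonality is the change of variables \<open>x = \<phi>\<^sub>1\<^sup>k(t) - T\<close>, whose Jacobian is the product of the
  \<open>Z\<^sup>2\<close> factors by the chain rule.

  Passing from \<open>\<pi>(T)\<close> to \<open>T / ln T\<close> needs the prime number theorem, which is proved by
  Newman's method: \<open>\<zeta>\<close> has no zero on \<open>Re s = 1\<close>, so the Dirichlet series with the bounded
  coefficients \<open>\<psi>(n)/n - 1\<close> continues analytically across that line, and Newman's Tauberian
  theorem makes it converge at \<open>s = 1\<close>. As \<open>\<psi>\<close> is monotone, this forces \<open>\<psi>(n) \<sim> n\<close>.
\<close>

section \<open>The zeta function near the line \<open>Re s = 1\<close>\<close>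

text \<open>The prime number theorem is forced by the units: the hypothesis measures
  \<open>T - \<phi>1 T\<close> by \<open>prime_pi T\<close>, and the iteration has to compare these
  units at different arguments asymptotic to \<open>T\<close>, which is elementary only for
  \<open>T / ln T\<close>. Part (iii) depends on Euler's constant being below 1: the gaps then have
  exact order \<open>T / ln T\<close>, while the intervals themselves are of smaller order.

  Newman's theorem asks for bounded coefficients, which excludes \<open>mangoldt\<close> itself; the
  averages \<open>chebyshev_psi n / n\<close> qualify by Chebyshev's estimate, obtained separately
  from binomial coefficients. Both continuations past the line come from one device,
  \<open>powr_step\<close>: replacing a difference of consecutive powers by the derivative leaves an
  error series that converges one unit further to the left. With coefficients 1 it continues zeta,
  with coefficients \<open>chebyshev_psi\<close> it continues the error made in partial
  summation.\<close>

lemma norm_of_nat_powr: "norm (of_nat n powr s :: complex) = real n powr Re s"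
  by (simp add: norm_powr_real_powr)

text \<open>Minus the remainder of the first-order Taylor expansion of \<open>x powr (-w)\<close>
  from \<open>n\<close> to \<open>n + 1\<close>. It is smaller than \<open>n powr (-w)\<close> by
  two powers of \<open>n\<close>.\<close>

definition powr_step :: "nat \<Rightarrow> complex \<Rightarrow> complex" where
  "powr_step n w = of_nat n powr (-w) - of_nat (Suc n) powr (-w) - w * of_nat n powr (-w - 1)"

text \<open>Taylor's theorem on the real segment from \<open>n\<close> to \<open>n + 1\<close>,
  which avoids the branch cut. The second derivative has modulus
  \<open>norm w * norm (w + 1)\<close> times a power of exponent \<open>- Re w - 2\<close>; for
  \<open>Re w \<ge> -2\<close> this power is largest at the left end.\<close>

lemma norm_powr_step_le:
  assumes n: "n > 0" and w: "Re w \<ge> -2"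
  shows "norm (powr_step n w) \<le> norm w * norm (w + 1) * real n powr (- Re w - 2)"
proof -
  define S where "S = closed_segment (of_nat n :: complex) (of_nat (Suc n))"
  have S: "z \<in> \<real> \<and> Re z \<ge> real n" if "z \<in> S" for z
  proof -
    have "S = of_real ` closed_segment (real n) (real (Suc n))"
      unfolding S_def closed_segment_of_real[symmetric] by simp
    with that obtain x where "z = of_real x" "x \<in> closed_segment (real n) (real (Suc n))" by auto
    thus ?thesis by (auto simp: closed_segment_eq_real_ivl split: if_splits)
  qed
  define f where "f = (\<lambda>i z. if i = 0 then z powr (-w) else if i = Suc 0 then -w * z powr (-w - 1)
        else w * (w + 1) * z powr (-w - 2))"
  have "cmod (f 0 (of_nat (Suc n)) - (\<Sum>i\<le>1. f i (of_nat n) * (of_nat (Suc n) - of_nat n) ^ i / fact i))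
      \<le> (norm w * norm (w + 1) * real n powr (- Re w - 2)) * cmod (of_nat (Suc n) - of_nat n) ^ Suc 1 / fact 1"
  proof (rule complex_Taylor[of S])
    show "convex S" by (simp add: S_def)
    show "of_nat n \<in> S" "of_nat (Suc n) \<in> S" by (auto simp: S_def)
    fix z assume z: "z \<in> S"
    have nz: "z \<notin> \<real>\<^sub>\<le>\<^sub>0" using S[OF z] n by (auto simp: complex_nonpos_Reals_iff)
    show "(f i has_field_derivative f (Suc i) z) (at z within S)" if "i \<le> 1" for i
    proof -
      from that consider "i = 0" | "i = 1" by linarith
      thus ?thesis
      proof cases
        case 1 with nz show ?thesis unfolding f_def
          by (auto intro!: derivative_eq_intros)
      next
        case 2 with nz show ?thesis unfolding f_def
          by (auto intro!: derivative_eq_intros simp: algebra_simps)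
      qed
    qed
    have "real n powr (- Re w - 2) \<ge> Re z powr (- Re w - 2)"
      using S[OF z] n w by (intro powr_mono2') auto
    thus "cmod (f (Suc 1) z) \<le> norm w * norm (w + 1) * real n powr (- Re w - 2)"
      using S[OF z] n by (auto simp: f_def norm_mult norm_powr_real_powr intro!: mult_left_mono)
  qed
  moreover have "f 0 (of_nat (Suc n)) - (\<Sum>i\<le>1. f i (of_nat n) * (of_nat (Suc n) - of_nat n) ^ i / fact i)
     = - powr_step n w"
    by (simp add: f_def powr_step_def algebra_simps)
  ultimately show ?thesis by simp
qed

lemma holomorphic_powr_step: "n > 0 \<Longrightarrow> powr_step n holomorphic_on A"
  unfolding powr_step_def by (intro holomorphic_intros) auto

text \<open>Around \<open>x\<close> the general term is O(n^(-1-d)), where \<open>d\<close> is half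
  the distance of \<open>x\<close> from the boundary line, so convergence is locally uniform. Used
  with \<open>\<alpha> = 0\<close>, \<open>w = s - 1\<close> for zeta and with
  \<open>\<alpha> = 1\<close>, \<open>w = s\<close> for \<open>chebyshev_psi\<close>.\<close>

lemma holomorphic_series_powr_step:
  fixes a :: "nat \<Rightarrow> complex"
  assumes a: "\<And>n. n > 0 \<Longrightarrow> norm (a n) \<le> C * real n powr \<alpha>" and \<alpha>: "\<alpha> \<ge> 0"
  shows "(\<lambda>w. \<Sum>n. a (Suc n) * powr_step (Suc n) w) holomorphic_on {w. Re w > \<alpha> - 1}"
    and "\<And>w. Re w > \<alpha> - 1 \<Longrightarrow> summable (\<lambda>n. a (Suc n) * powr_step (Suc n) w)"
proof -
  let ?S = "{w. Re w > \<alpha> - 1}"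
  let ?f = "\<lambda>n w. a (Suc n) * powr_step (Suc n) w"
  have C: "C \<ge> 0" using order_trans[OF norm_ge_zero a[of 1]] by simp
  have op: "open ?S" by (rule open_halfspace_Re_gt)
  have "\<exists>d h. 0 < d \<and> summable h \<and> range h \<subseteq> \<real>\<^sub>\<ge>\<^sub>0 \<and> (\<forall>\<^sub>F n in sequentially. \<forall>y\<in>ball x d \<inter> ?S. cmod (?f n y) \<le> cmod (h n))"
    if x: "x \<in> ?S" for x
  proof -
    define d where "d = (Re x - (\<alpha> - 1)) / 2"
    have d: "d > 0" using x by (simp add: d_def)
    define K where "K = (norm x + d) * (norm x + d + 1)"
    define h where "h = (\<lambda>n. complex_of_real (C * K * real (Suc n) powr (- 1 - d)))"
    have K: "K \<ge> 0" using d by (simp add: K_def)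
    have "summable (\<lambda>n. real n powr (-1 - d))" using d by (simp add: summable_real_powr_iff)
    hence "summable (\<lambda>n. C * K * real (Suc n) powr (- 1 - d))"
      by (intro summable_mult) (subst summable_Suc_iff, auto)
    hence "summable h" unfolding h_def by (subst summable_of_real_iff)
    moreover have "range h \<subseteq> \<real>\<^sub>\<ge>\<^sub>0"
      unfolding h_def using C K by (auto simp: complex_nonneg_Reals_iff simp del: of_nat_Suc)
    moreover have "cmod (?f n y) \<le> cmod (h n)" if y: "y \<in> ball x d \<inter> ?S" for n y
    proof -
      have "norm (y - x) < d" using y by (simp add: dist_norm norm_minus_commute)
      hence ny: "norm y \<le> norm x + d" using norm_triangle_sub[of y x] by linarith
      have ny1: "norm (y + 1) \<le> norm x + d + 1" using norm_triangle_ineq[of y 1] ny by simp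
      have "\<bar>Re (y - x)\<bar> < d" using abs_Re_le_cmod[of "y - x"] \<open>norm (y - x) < d\<close> by linarith
      hence Re: "Re y \<ge> \<alpha> - 1 + d" unfolding d_def by (auto simp: field_simps abs_if split: if_splits)
      have "cmod (?f n y) \<le> (C * real (Suc n) powr \<alpha>) * (norm y * norm (y + 1) * real (Suc n) powr (- Re y - 2))"
        unfolding norm_mult using a[of "Suc n", OF zero_less_Suc] norm_powr_step_le[of "Suc n" y] Re \<alpha> d C
        by (intro mult_mono) (auto simp del: of_nat_Suc)
      also have "\<dots> \<le> (C * real (Suc n) powr \<alpha>) * (K * real (Suc n) powr (- \<alpha> - 1 - d))"
        unfolding K_def using Re C d ny ny1
        by (intro mult_left_mono mult_mono powr_mono) (auto simp del: of_nat_Suc)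
      also have "\<dots> = C * K * real (Suc n) powr (- 1 - d)"
        by (simp add: powr_add[symmetric] mult_ac del: of_nat_Suc)
      also have "\<dots> = cmod (h n)" using C K by (simp add: h_def norm_mult abs_mult del: of_nat_Suc)
      finally show ?thesis .
    qed
    ultimately show ?thesis using d by (intro exI[of _ d] exI[of _ h]) auto
  qed
  moreover have "(?f n has_field_derivative deriv (?f n) x) (at x)" for n x
  proof -
    have "?f n holomorphic_on UNIV" by (intro holomorphic_intros holomorphic_powr_step) auto
    thus ?thesis by (rule holomorphic_derivI) auto
  qed
  ultimately obtain g g' where g: "\<forall>x\<in>?S. ((\<lambda>n. ?f n x) sums g x) \<and> (\<lambda>n. deriv (?f n) x) sums g' x \<and> (g has_field_derivative g' x) (at x)"
    using series_and_derivative_comparison_complex[OF op, of ?f "\<lambda>n. deriv (?f n)"] by blast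
  show "summable (\<lambda>n. ?f n w)" if "Re w > \<alpha> - 1" for w
    using g that by (auto simp: sums_iff)
  have "g holomorphic_on ?S" using g op by (auto simp: holomorphic_on_open)
  thus "(\<lambda>w. \<Sum>n. ?f n w) holomorphic_on ?S"
    by (rule holomorphic_transform) (use g in \<open>auto simp: sums_iff\<close>)
qed

text \<open>Absolute convergence at every real exponent beyond 1 gives a majorant on a ball around
  \<open>s\<close>, and with it termwise differentiation. Serves both for zeta and for the
  \<open>mangoldt\<close> series.\<close>

lemma dirichlet_series_deriv:
  fixes a :: "nat \<Rightarrow> complex"
  assumes a: "\<And>\<sigma>::real. \<sigma> > 1 \<Longrightarrow> summable (\<lambda>n. norm (a n) * real n powr (-\<sigma>))" and s: "Re s > 1"
  shows "summable (\<lambda>n. norm (a n * of_nat n powr (-s)))"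
    and "((\<lambda>s. \<Sum>n. a n * of_nat n powr (-s)) has_field_derivative
            (\<Sum>n. - (a n * of_real (ln (real n)) * of_nat n powr (-s)))) (at s)"
proof -
  let ?S = "{w. Re w > 1}"
  let ?f = "\<lambda>n s. a n * of_nat n powr (-s)"
  let ?f' = "\<lambda>n s. - (a n * of_real (ln (real n)) * of_nat n powr (-s))"
  show "summable (\<lambda>n. norm (a n * of_nat n powr (-s)))"
    using a[OF s] by (simp add: norm_mult norm_of_nat_powr)
  have op: "open ?S" by (rule open_halfspace_Re_gt)
  have der: "(?f n has_field_derivative ?f' n x) (at x)" for n x
  proof (cases "n = 0")
    case False
    hence "((\<lambda>z. of_nat n powr (- z)) has_field_derivative (Ln (of_nat n) * of_nat n powr (-x)) * (-1)) (at x)"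
      by (intro DERIV_chain2[OF has_field_derivative_powr_right] derivative_intros) auto
    from DERIV_cmult[OF this, of "a n"] False show ?thesis
      by (simp add: Ln_of_nat mult_ac)
  qed simp
  have "\<exists>d h. 0 < d \<and> summable h \<and> range h \<subseteq> \<real>\<^sub>\<ge>\<^sub>0 \<and> (\<forall>\<^sub>F n in sequentially. \<forall>y\<in>ball x d \<inter> ?S. cmod (?f n y) \<le> cmod (h n))"
    if x: "x \<in> ?S" for x
  proof -
    define d where "d = (Re x - 1) / 2"
    have d: "d > 0" using x by (simp add: d_def)
    define h where "h = (\<lambda>n. complex_of_real (norm (a n) * real n powr (-(1+d))))"
    have "summable h" unfolding h_def using a[of "1 + d"] d by (subst summable_of_real_iff) simp
    moreover have "range h \<subseteq> \<real>\<^sub>\<ge>\<^sub>0"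
      unfolding h_def by (auto simp: complex_nonneg_Reals_iff)
    moreover have "cmod (?f n y) \<le> cmod (h n)" if y: "y \<in> ball x d \<inter> ?S" for n y
    proof (cases "n = 0")
      case False
      have "norm (y - x) < d" using y by (simp add: dist_norm norm_minus_commute)
      hence "\<bar>Re (y - x)\<bar> < d" using abs_Re_le_cmod[of "y - x"] by linarith
      hence "Re y \<ge> 1 + d" unfolding d_def by (auto simp: field_simps abs_if split: if_splits)
      thus ?thesis using False
        by (auto simp: h_def norm_mult norm_of_nat_powr intro!: mult_left_mono powr_mono)
    qed (auto simp: h_def)
    ultimately show ?thesis using d by (intro exI[of _ d] exI[of _ h]) auto
  qed
  from series_and_derivative_comparison_complex[OF op, of ?f ?f', OF der this]
  obtain g g' where g: "\<forall>x\<in>?S. (\<lambda>n. ?f n x) sums g x \<and> (\<lambda>n. ?f' n x) sums g' x \<and> (g has_field_derivative g' x) (at x)"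
    by blast
  have gs: "g x = (\<Sum>n. ?f n x)" if "x \<in> ?S" for x
    using g that sums_unique by blast
  have "((\<lambda>s. \<Sum>n. ?f n s) has_field_derivative g' s) (at s)"
    by (rule has_field_derivative_transform_within_open[of g "g' s" s ?S]) (use g gs s op in blast)+
  moreover have "g' s = (\<Sum>n. ?f' n s)"
    using g s sums_unique by blast
  ultimately show "((\<lambda>s. \<Sum>n. ?f n s) has_field_derivative (\<Sum>n. ?f' n s)) (at s)" by simp
qed

text \<open>Since \<open>0 powr z = 0\<close>, Dirichlet series may be summed from \<open>n = 0\<close>.\<close>

definition zeta_sum :: "complex \<Rightarrow> complex" where
  "zeta_sum s = (\<Sum>n. of_nat n powr (-s))"

definition mangoldt_series :: "complex \<Rightarrow> complex" where
  "mangoldt_series s = (\<Sum>n. mangoldt n * of_nat n powr (-s))"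

text \<open>The holomorphic continuation of \<open>(s - 1) \<zeta>(s)\<close> to the half-plane \<open>Re s > 0\<close>.\<close>

definition zeta_reg :: "complex \<Rightarrow> complex" where
  "zeta_reg s = 1 - (\<Sum>n. powr_step (Suc n) (s - 1))"

lemma holomorphic_zeta_reg: "zeta_reg holomorphic_on {s. Re s > 0}"
proof -
  have "(\<lambda>w. \<Sum>n. 1 * powr_step (Suc n) w) holomorphic_on {w. Re w > 0 - 1}"
    by (rule holomorphic_series_powr_step(1)[where C = 1]) (auto simp: powr_def)
  hence "((\<lambda>w. \<Sum>n. powr_step (Suc n) w) \<circ> (\<lambda>s. s - 1)) holomorphic_on {s. Re s > 0}"
    by (intro holomorphic_on_compose_gen[where t = "{w. Re w > 0 - 1}"] holomorphic_intros) auto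
  thus ?thesis unfolding zeta_reg_def o_def by (intro holomorphic_intros)
qed

text \<open>Each \<open>powr_step\<close> vanishes at \<open>w = 0\<close>. The value is the residue
  of zeta at its pole, and it is the known nonzero value on which the non-vanishing arguments
  rest.\<close>

lemma zeta_reg_1 [simp]: "zeta_reg 1 = 1"
  by (simp add: zeta_reg_def powr_step_def del: of_nat_Suc)

lemma summable_ln_powr:
  assumes "\<sigma> > 1" shows "summable (\<lambda>n. ln (real n) * real n powr (-\<sigma>))"
proof (rule summable_comparison_test)
  \<comment> \<open>Half of the excess over 1 absorbs the logarithm, the other half is left for
    convergence.\<close>
  define e where "e = (\<sigma> - 1) / 2"
  have e: "e > 0" using assms by (simp add: e_def)
  show "summable (\<lambda>n. (1/e) * real n powr (- 1 - e))"
    using e by (intro summable_mult) (simp add: summable_real_powr_iff)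
  show "\<exists>N. \<forall>n\<ge>N. norm (ln (real n) * real n powr - \<sigma>) \<le> (1/e) * real n powr (- 1 - e)"
  proof (intro exI allI impI)
    fix n :: nat assume n: "n \<ge> 1"
    have "ln (real n) * real n powr - \<sigma> \<le> real n powr e / e * real n powr - \<sigma>"
      using ln_powr_bound[of "real n" e] n e by (intro mult_right_mono) auto
    also have "\<dots> = (1/e) * real n powr (e - \<sigma>)" by (simp add: powr_diff powr_minus field_simps)
    also have "e - \<sigma> = -1 - e" by (simp add: e_def field_simps)
    finally show "norm (ln (real n) * real n powr - \<sigma>) \<le> (1/e) * real n powr (- 1 - e)"
      using n by simp
  qed
qed

lemma mangoldt_le_ln: "mangoldt n \<le> ln (real n)"
  by (cases "n = 0") (auto intro: mangoldt_le)

lemma summable_mangoldt_powr: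
  assumes "\<sigma> > 1" shows "summable (\<lambda>n. norm (mangoldt n :: complex) * real n powr (-\<sigma>))"
  by (rule summable_comparison_test'[OF summable_ln_powr[OF assms], of 0])
     (auto simp: abs_mult intro!: mult_right_mono mangoldt_le_ln)

lemma zeta_sum_deriv:
  assumes "Re s > 1"
  shows "summable (\<lambda>n. norm (of_nat n powr (-s) :: complex))"
    and "(zeta_sum has_field_derivative
            - (\<Sum>n. of_real (ln (real n)) * of_nat n powr (-s))) (at s)"
proof -
  have *: "summable (\<lambda>n. norm (1::complex) * real n powr (-\<sigma>))" if "\<sigma> > 1" for \<sigma>
    using that by (simp add: summable_real_powr_iff)
  note D = dirichlet_series_deriv[of "\<lambda>_. 1", OF * assms]
  show "summable (\<lambda>n. norm (of_nat n powr (-s) :: complex))" using D(1) by simp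
  have ln_nonneg: "ln (real n) \<ge> 0" for n by (cases "n = 0") auto
  have "summable (\<lambda>n. of_real (ln (real n)) * of_nat n powr (-s) :: complex)"
    using summable_ln_powr[OF assms]
    by (intro summable_norm_cancel[of "\<lambda>n. of_real (ln (real n)) * of_nat n powr (-s)"])
       (simp add: norm_mult norm_of_nat_powr ln_nonneg)
  hence "(\<Sum>n. - (of_real (ln (real n)) * of_nat n powr (-s) :: complex))
     = - (\<Sum>n. of_real (ln (real n)) * of_nat n powr (-s))" by (rule suminf_minus)
  thus "(zeta_sum has_field_derivative
            - (\<Sum>n. of_real (ln (real n)) * of_nat n powr (-s))) (at s)"
    using D(2) unfolding zeta_sum_def by simp
qed

text \<open>Summed with \<open>w = s - 1\<close>, the differences of powers telescope to 1, because
  n^(1-s) tends to 0, and the linear terms add up to \<open>(s - 1) * zeta_sum s\<close>.\<close>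

lemma zeta_reg_eq:
  assumes "Re s > 1"
  shows "zeta_reg s = (s - 1) * zeta_sum s"
proof -
  define u :: "nat \<Rightarrow> complex" where "u = (\<lambda>n. of_nat (Suc n) powr (-(s - 1)))"
  have "(\<lambda>n. norm (u n)) = (\<lambda>n. real (Suc n) powr (-(Re s - 1)))"
    by (auto simp: u_def norm_of_nat_powr simp del: of_nat_Suc)
  moreover have "(\<lambda>n. real (Suc n) powr (-(Re s - 1))) \<longlonglongrightarrow> 0"
    using assms by real_asymp
  ultimately have "u \<longlonglongrightarrow> 0" by (subst tendsto_norm_zero_iff[symmetric]) simp
  hence 1: "(\<lambda>n. u n - u (Suc n)) sums (u 0 - 0)" by (rule telescope_sums')
  have "(\<lambda>n. of_nat n powr (-s)) sums zeta_sum s"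
    unfolding zeta_sum_def using zeta_sum_deriv(1)[OF assms] by (simp add: summable_norm_cancel summable_sums)
  hence "(\<lambda>n. of_nat (Suc n) powr (-s)) sums zeta_sum s"
    by (subst sums_Suc_iff) simp
  hence 2: "(\<lambda>n. (s - 1) * of_nat (Suc n) powr (-s)) sums ((s - 1) * zeta_sum s)" by (rule sums_mult)
  have "(\<lambda>n. powr_step (Suc n) (s - 1)) sums (u 0 - 0 - (s - 1) * zeta_sum s)"
    using sums_diff[OF 1 2] by (simp add: u_def powr_step_def)
  thus ?thesis unfolding zeta_reg_def by (simp add: sums_iff u_def)
qed

section \<open>The Dirichlet product of zeta and the von Mangoldt series\<close>

lemma has_sum_mult_Times:
  fixes f :: "'a \<Rightarrow> complex" and g :: "'b \<Rightarrow> complex"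
  assumes f: "(f has_sum a) A" "(\<lambda>x. norm (f x)) summable_on A"
    and g: "(g has_sum b) B" "(\<lambda>x. norm (g x)) summable_on B"
  shows "((\<lambda>(x, y). f x * g y) has_sum (a * b)) (A \<times> B)"
proof (rule has_sum_SigmaI)
  show "((\<lambda>y. case (x, y) of (x, y) \<Rightarrow> f x * g y) has_sum f x * b) B" for x
    using has_sum_cmult_right[OF g(1)] by simp
  show "((\<lambda>x. f x * b) has_sum a * b) A" using has_sum_cmult_left[OF f(1)] .
  have "(\<lambda>p. norm (case p of (x, y) \<Rightarrow> f x * g y)) summable_on A \<times> B"
  proof (rule summable_on_SigmaI)
    show "((\<lambda>y. norm (case (x, y) of (x, y) \<Rightarrow> f x * g y)) has_sum norm (f x) * infsum (\<lambda>y. norm (g y)) B) B" for x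
      using has_sum_cmult_right[OF has_sum_infsum[OF g(2)]] by (simp add: norm_mult)
    show "(\<lambda>x. norm (f x) * infsum (\<lambda>y. norm (g y)) B) summable_on A"
      using f(2) by (rule summable_on_cmult_left)
  qed auto
  thus "(\<lambda>(x, y). f x * g y) summable_on A \<times> B" by (rule abs_summable_summable)
qed

text \<open>The absolutely convergent double series over pairs \<open>(d, m)\<close> is regrouped by
  \<open>n = d * m\<close>, and the sum of \<open>mangoldt\<close> over the divisors of
  \<open>n\<close> is \<open>ln n\<close>. The right-hand side is minus the derivative of zeta;
  stated as a product, the identity does not presuppose that zeta has no zeros, which is deduced
  from it.\<close>

lemma zeta_sum_mult_mangoldt_series:
  assumes s: "Re s > 1"
  shows "zeta_sum s * mangoldt_series s = (\<Sum>n. of_real (ln (real n)) * of_nat n powr (-s))"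
proof -
  \<comment> \<open>The index 0 is removed since every number divides 0, so its set of divisors is
    infinite.\<close>
  have UNIV_iff: "(f has_sum a) {0<..} \<longleftrightarrow> (f has_sum a) UNIV"
    if "f 0 = 0" for f :: "nat \<Rightarrow> complex" and a
    using that by (intro has_sum_cong_neutral) (auto simp: not_less)
  have sums_pos: "(f has_sum suminf f) {0<..} \<and> (\<lambda>x. norm (f x)) summable_on {0<..}"
    if "summable (\<lambda>n. norm (f n))" "f 0 = 0" for f :: "nat \<Rightarrow> complex"
  proof
    have "(f has_sum suminf f) UNIV"
      using that by (intro norm_summable_imp_has_sum summable_sums summable_norm_cancel[of f]) auto
    thus "(f has_sum suminf f) {0<..}"
      using that(2) by (simp add: UNIV_iff)
    have "(\<lambda>x. norm (f x)) summable_on UNIV"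
      using that(1) by (intro summable_nonneg_imp_summable_on) auto
    thus "(\<lambda>x. norm (f x)) summable_on {0<..}" by (rule summable_on_subset_banach) auto
  qed
  define f :: "nat \<Rightarrow> complex" where "f = (\<lambda>n. mangoldt n * of_nat n powr (-s))"
  define g :: "nat \<Rightarrow> complex" where "g = (\<lambda>n. of_nat n powr (-s))"
  define h :: "nat \<Rightarrow> complex" where "h = (\<lambda>n. of_real (ln (real n)) * of_nat n powr (-s))"
  have sf: "summable (\<lambda>n. norm (f n))"
    using dirichlet_series_deriv(1)[OF summable_mangoldt_powr s] by (simp add: f_def)
  have sg: "summable (\<lambda>n. norm (g n))" unfolding g_def using zeta_sum_deriv(1)[OF s] .
  have F: "(f has_sum mangoldt_series s) {0<..}" "(\<lambda>x. norm (f x)) summable_on {0<..}"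
    using sums_pos[OF sf] by (auto simp: f_def mangoldt_series_def)
  have G: "(g has_sum zeta_sum s) {0<..}" "(\<lambda>x. norm (g x)) summable_on {0<..}"
    using sums_pos[OF sg] by (auto simp: g_def zeta_sum_def)
  have "((\<lambda>(d, m). f d * g m) has_sum (mangoldt_series s * zeta_sum s)) ({0<..} \<times> {0<..})"
    by (rule has_sum_mult_Times[OF F G])
  also have "?this \<longleftrightarrow> ((\<lambda>(n, d). f d * g (n div d)) has_sum (mangoldt_series s * zeta_sum s))
       (SIGMA n:{0<..}. {d. d dvd n})"
    by (rule has_sum_reindex_bij_witness[of _ "\<lambda>(n, d). (d, n div d)" "\<lambda>(d, m). (d * m, d)"])
       (auto elim!: dvdE intro!: Nat.gr0I)
  finally have "((\<lambda>n. \<Sum>d | d dvd n. f d * g (n div d)) has_sum (mangoldt_series s * zeta_sum s)) {0<..}"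
    by (rule has_sum_Sigma') (auto intro!: has_sum_finite)
  also have "?this \<longleftrightarrow> (h has_sum (mangoldt_series s * zeta_sum s)) {0<..}"
  proof (rule has_sum_cong)
    fix n :: nat assume n: "n \<in> {0<..}"
    have "(\<Sum>d | d dvd n. f d * g (n div d)) = (\<Sum>d | d dvd n. mangoldt d * of_nat n powr (-s))"
    proof (rule sum.cong)
      fix d assume "d \<in> {d. d dvd n}"
      then obtain m where m: "n = d * m" by auto
      have "(of_nat n :: complex) powr (-s) = of_nat d powr (-s) * of_nat m powr (-s)"
        unfolding m of_nat_mult by (rule powr_times_real) auto
      thus "f d * g (n div d) = mangoldt d * of_nat n powr (-s)"
        using n m by (auto simp: f_def g_def)
    qed auto
    also have "\<dots> = h n" using n mangoldt_sum[of n, where 'a = complex]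
      by (simp add: h_def sum_distrib_right[symmetric])
    finally show "(\<Sum>d | d dvd n. f d * g (n div d)) = h n" .
  qed
  finally have "(h has_sum (mangoldt_series s * zeta_sum s)) UNIV"
    by (subst (asm) UNIV_iff) (auto simp: h_def)
  from has_sum_imp_sums[OF this] show ?thesis by (simp add: h_def sums_iff mult.commute)
qed

section \<open>Non-vanishing of zeta for Re s >= 1\<close>

lemma tendsto_real_at_right_complex:
  fixes f :: "complex \<Rightarrow> complex"
  assumes "isCont f z"
  shows "((\<lambda>x::real. f (z + of_real x)) \<longlongrightarrow> f z) (at_right 0)"
  by (rule isCont_tendsto_compose[OF assms]) (auto intro!: tendsto_eq_intros)

text \<open>For a primitive \<open>P\<close> of \<open>mangoldt_series\<close>, the product of
  \<open>zeta_sum\<close> and \<open>exp P\<close> has derivative 0. A single zero would therefore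
  make zeta vanish on the whole half-plane, against \<open>zeta_reg 1 = 1\<close> and continuity
  from the right.\<close>

lemma zeta_sum_nonzero:
  assumes s: "Re s > 1" shows "zeta_sum s \<noteq> 0"
proof
  assume z: "zeta_sum s = 0"
  let ?S = "{s. Re s > 1}"
  have op: "open ?S" and cv: "convex ?S"
    by (auto intro: open_halfspace_Re_gt convex_halfspace_Re_gt)
  have der: "(zeta_sum has_field_derivative - (zeta_sum x * mangoldt_series x)) (at x)" if "Re x > 1" for x
    using zeta_sum_deriv(2)[OF that] zeta_sum_mult_mangoldt_series[OF that] by simp
  have "mangoldt_series holomorphic_on ?S"
    using dirichlet_series_deriv(2)[OF summable_mangoldt_powr]
    unfolding holomorphic_on_open[OF op] mangoldt_series_def by blast
  then obtain P where P: "\<And>x. x \<in> ?S \<Longrightarrow> (P has_field_derivative mangoldt_series x) (at x within ?S)"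
    using holomorphic_convex_primitive'[OF cv op] by blast
  have "\<exists>c. \<forall>x\<in>?S. zeta_sum x * exp (P x) = c"
  proof (rule has_field_derivative_zero_constant[OF cv])
    fix x assume x: "x \<in> ?S"
    show "((\<lambda>x. zeta_sum x * exp (P x)) has_field_derivative 0) (at x within ?S)"
      using P[OF x] x der[of x, THEN has_field_derivative_at_within]
      by (auto intro!: derivative_eq_intros)
  qed
  then obtain c where c: "\<And>x. x \<in> ?S \<Longrightarrow> zeta_sum x * exp (P x) = c" by blast
  from c[of s] s z have "c = 0" by simp
  with c have zero: "zeta_reg x = 0" if "Re x > 1" for x
    using that by (force simp: zeta_reg_eq)
  have "isCont zeta_reg 1"
    using holomorphic_on_imp_continuous_on[OF holomorphic_zeta_reg]
    by (rule continuous_on_interior) (auto simp: interior_open open_halfspace_Re_gt)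
  hence "((\<lambda>x::real. zeta_reg (1 + of_real x)) \<longlongrightarrow> zeta_reg 1) (at_right 0)"
    by (rule tendsto_real_at_right_complex)
  moreover have "eventually (\<lambda>x::real. zeta_reg (1 + of_real x) = 0) (at_right 0)"
    using eventually_at_right_less[of "0::real"] by eventually_elim (simp add: zero)
  ultimately have "zeta_reg 1 = 0"
    using tendsto_eventually tendsto_unique trivial_limit_at_right_real by metis
  thus False by simp
qed

lemma zeta_reg_nonzero: "Re s > 1 \<Longrightarrow> zeta_reg s \<noteq> 0"
  using zeta_sum_nonzero[of s] by (auto simp: zeta_reg_eq)

lemma zeta_reg_logderiv:
  assumes s: "Re s > 1"
  shows "deriv zeta_reg s / zeta_reg s = 1 / (s - 1) - mangoldt_series s"
proof -
  have "((\<lambda>s. (s - 1) * zeta_sum s) has_field_derivative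
           (zeta_sum s - (s - 1) * (zeta_sum s * mangoldt_series s))) (at s)"
    using zeta_sum_deriv(2)[OF s] zeta_sum_mult_mangoldt_series[OF s]
    by (auto intro!: derivative_eq_intros)
  hence "(zeta_reg has_field_derivative (zeta_sum s - (s - 1) * (zeta_sum s * mangoldt_series s))) (at s)"
    by (rule has_field_derivative_transform_within_open[OF _ open_halfspace_Re_gt[of 1]])
       (use s in \<open>auto simp: zeta_reg_eq\<close>)
  hence "deriv zeta_reg s = zeta_sum s * (1 - (s - 1) * mangoldt_series s)"
    by (simp add: DERIV_imp_deriv algebra_simps)
  hence "deriv zeta_reg s / zeta_reg s = (1 - (s - 1) * mangoldt_series s) / (s - 1)"
    using zeta_sum_nonzero[OF s] by (simp add: zeta_reg_eq[OF s])
  moreover have "s \<noteq> 1" using s by auto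
  ultimately show ?thesis by (simp add: diff_divide_distrib)
qed

text \<open>The number \<open>m\<close> is the order of the zero at \<open>z\<close>: if f = (w -
  z)^m g, then f'/f = m/(w - z) + g'/g. The approach is along the real direction from the right,
  where the Dirichlet series are available. The assumption \<open>nz\<close> excludes a zero of
  infinite order.\<close>

lemma logderiv_order_limit:
  assumes hol: "f holomorphic_on S" and S: "open S" "connected S" and z: "z \<in> S"
    and nz: "\<exists>w\<in>S. f w \<noteq> 0"
  shows "\<exists>m::nat. ((\<lambda>x::real. of_real x * (deriv f (z + of_real x) / f (z + of_real x))) \<longlongrightarrow> of_nat m) (at_right 0)
            \<and> (m = 0 \<longrightarrow> f z \<noteq> 0)"
proof (cases "f z = 0")
  case False
  have "f analytic_on {z}" using hol S z by (meson analytic_at)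
  hence "isCont f z" "isCont (deriv f) z"
    by (auto intro!: analytic_at_imp_isCont analytic_deriv)
  hence "((\<lambda>x::real. of_real x * (deriv f (z + of_real x) / f (z + of_real x))) \<longlongrightarrow> of_real 0 * (deriv f z / f z)) (at_right 0)"
    using False by (intro tendsto_intros tendsto_real_at_right_complex) auto
  thus ?thesis using False by (intro exI[of _ 0]) auto
next
  case True
  have "\<not> f constant_on S" using nz True z unfolding constant_on_def by metis
  from holomorphic_factor_zero_nonconstant[OF hol S z True this]
  obtain g r n where g: "0 < n" "0 < r" "ball z r \<subseteq> S" "g holomorphic_on ball z r"
     "\<And>w. w \<in> ball z r \<Longrightarrow> f w = (w - z) ^ n * g w" "\<And>w. w \<in> ball z r \<Longrightarrow> g w \<noteq> 0" by metis
  have "g analytic_on {z}" using g(2,4) by (meson analytic_at open_ball centre_in_ball)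
  hence "isCont g z" "isCont (deriv g) z"
    by (auto intro!: analytic_at_imp_isCont analytic_deriv)
  hence "((\<lambda>x::real. of_nat n + of_real x * (deriv g (z + of_real x) / g (z + of_real x))) \<longlongrightarrow>
            of_nat n + of_real 0 * (deriv g z / g z)) (at_right 0)"
    using g(2,6) by (intro tendsto_intros tendsto_real_at_right_complex) auto
  moreover have "eventually (\<lambda>x::real. of_nat n + of_real x * (deriv g (z + of_real x) / g (z + of_real x))
      = of_real x * (deriv f (z + of_real x) / f (z + of_real x))) (at_right 0)"
    using eventually_at_right_less[of "0::real"] eventually_at_right_real[OF g(2)]
  proof eventually_elim
    case (elim x)
    define w where "w = z + complex_of_real x"
    have w: "w \<in> ball z r" using elim by (simp add: w_def dist_norm)
    have "(g has_field_derivative deriv g w) (at w)"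
      using g(4) w by (intro holomorphic_derivI) auto
    hence "((\<lambda>w. (w - z) ^ n * g w) has_field_derivative
        of_nat n * (w - z) ^ (n - 1) * g w + (w - z) ^ n * deriv g w) (at w)"
      by (auto intro!: derivative_eq_intros)
    hence "(f has_field_derivative
        of_nat n * (w - z) ^ (n - 1) * g w + (w - z) ^ n * deriv g w) (at w)"
      by (rule has_field_derivative_transform_within_open[OF _ open_ball w]) (simp add: g(5))
    hence "deriv f w = of_nat n * (w - z) ^ (n - 1) * g w + (w - z) ^ n * deriv g w"
      by (rule DERIV_imp_deriv)
    moreover have "w - z = of_real x" by (simp add: w_def)
    moreover have "complex_of_real x ^ n = of_real x * of_real x ^ (n - 1)"
      using g(1) by (cases n) auto
    ultimately have "of_nat n + of_real x * (deriv g w / g w) = of_real x * (deriv f w / f w)"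
      using elim g(5)[OF w] g(6)[OF w] by (simp add: field_simps)
    thus ?case by (simp add: w_def)
  qed
  ultimately have "((\<lambda>x::real. of_real x * (deriv f (z + of_real x) / f (z + of_real x))) \<longlongrightarrow> of_nat n) (at_right 0)"
    by (simp add: tendsto_cong)
  thus ?thesis using g(1) by (intro exI[of _ n]) auto
qed

text \<open>The term of index \<open>n\<close> has real part
  \<open>mangoldt n * n powr (-\<sigma>)\<close> times 3 + 4 cos x + cos 2x with x = t ln n, and
  this trigonometric factor is the square 2 (1 + cos x)^2.\<close>

lemma three_four_one:
  assumes \<sigma>: "\<sigma> > (1::real)"
  shows "0 \<le> Re (3 * mangoldt_series (of_real \<sigma>) + 4 * mangoldt_series (Complex \<sigma> t) + mangoldt_series (Complex \<sigma> (2 * t)))"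
proof -
  define f where "f = (\<lambda>t n. (mangoldt n :: complex) * of_nat n powr (- Complex \<sigma> t))"
  have S: "f t sums mangoldt_series (Complex \<sigma> t)" for t
    using dirichlet_series_deriv(1)[OF summable_mangoldt_powr, of "Complex \<sigma> t"] \<sigma>
    unfolding f_def mangoldt_series_def by (auto intro!: summable_sums simp: summable_norm_cancel)
  have Re_f: "Re (f t n) = mangoldt n * real n powr (- \<sigma>) * cos (t * ln n)" for t n
  proof (cases "n = 0")
    case False
    have "of_nat n powr (- Complex \<sigma> t) = of_real (real n powr (- \<sigma>)) * cis (- (t * ln n))"
      using False by (simp add: powr_def exp_eq_polar Ln_of_nat algebra_simps)
    moreover have "f t n = of_real (mangoldt n) * of_nat n powr (- Complex \<sigma> t)"
      by (simp add: f_def)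
    ultimately show ?thesis by (simp del: of_real_mangoldt)
  qed (simp add: f_def)
  have "(\<lambda>n. Re (3 * f 0 n + 4 * f t n + f (2 * t) n)) sums
     Re (3 * mangoldt_series (Complex \<sigma> 0) + 4 * mangoldt_series (Complex \<sigma> t) + mangoldt_series (Complex \<sigma> (2 * t)))"
    by (intro sums_Re sums_add sums_mult S)
  moreover have "Re (3 * f 0 n + 4 * f t n + f (2 * t) n) \<ge> 0" for n
  proof -
    have "Re (3 * f 0 n + 4 * f t n + f (2 * t) n) =
       mangoldt n * real n powr (- \<sigma>) * (3 + 4 * cos (t * ln n) + cos (2 * (t * ln n)))"
      by (simp add: Re_f algebra_simps)
    also have "3 + 4 * cos (t * ln n) + cos (2 * (t * ln n)) = 2 * (1 + cos (t * ln n))\<^sup>2"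
      unfolding cos_double_cos by (simp add: power2_eq_square algebra_simps)
    finally show ?thesis by (simp add: mangoldt_nonneg)
  qed
  ultimately have "0 \<le> Re (3 * mangoldt_series (Complex \<sigma> 0) + 4 * mangoldt_series (Complex \<sigma> t) + mangoldt_series (Complex \<sigma> (2 * t)))"
    by (rule sums_le[OF _ sums_zero, rotated])
  thus ?thesis unfolding complex_of_real_def .
qed

text \<open>Multiply \<open>three_four_one\<close> by \<open>x = \<sigma> - 1\<close> and let
  \<open>x\<close> tend to 0. The pole at 1 contributes 3, zeros of orders \<open>m1\<close> and
  \<open>m2\<close> at heights \<open>t\<close> and \<open>2 * t\<close> contribute
  \<open>- 4 * m1 - m2\<close>. The total cannot be negative, and since 4 exceeds 3 this leaves only
  \<open>m1 = 0\<close>.\<close>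

lemma zeta_reg_nonzero_line: "zeta_reg (Complex 1 t) \<noteq> 0"
proof (cases "t = 0")
  case True
  hence "Complex 1 t = 1" by (simp add: complex_eq_iff)
  thus ?thesis by simp
next
  case False
  let ?S = "{s. Re s > 0}"
  let ?L = "\<lambda>z x. of_real x * (deriv zeta_reg (z + of_real x) / zeta_reg (z + of_real x))"
  let ?M = "\<lambda>z x. of_real x * mangoldt_series (z + of_real x)"
  have one: "1 \<in> ?S" "zeta_reg 1 \<noteq> 0" by auto
  have lim: "\<exists>m::nat. (?L z \<longlongrightarrow> of_nat m) (at_right 0) \<and> (m = 0 \<longrightarrow> zeta_reg z \<noteq> 0)" if "Re z > 0" for z
    by (rule logderiv_order_limit[OF holomorphic_zeta_reg open_halfspace_Re_gt
          convex_connected[OF convex_halfspace_Re_gt]]) (use that one in blast)+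
  \<comment> \<open>By \<open>zeta_reg_logderiv\<close>, \<open>?M z x\<close> equals
    \<open>x / (z + x - 1) - ?L z x\<close>; the first term carries the pole and survives in the
    limit only for \<open>z = 1\<close>.\<close>
  have M_lim: "(?M z \<longlongrightarrow> (if z = 1 then 1 else 0) - c) (at_right 0)"
    if "(?L z \<longlongrightarrow> c) (at_right 0)" "Re z = 1" for z c
  proof -
    have "((\<lambda>x. of_real x / (z + of_real x - 1)) \<longlongrightarrow> (if z = 1 then 1 else 0)) (at_right 0)"
    proof (cases "z = 1")
      case True
      have "eventually (\<lambda>x. of_real x / (z + of_real x - 1) = 1) (at_right 0)"
        using eventually_at_right_less[of "0::real"] by eventually_elim (simp add: True)
      thus ?thesis using True by (simp add: tendsto_eventually)
    next
      case False
      have "((\<lambda>x. of_real x / (z + of_real x - 1)) \<longlongrightarrow> of_real 0 / (z + of_real 0 - 1)) (at_right 0)"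
        using False by (intro tendsto_intros) auto
      thus ?thesis using False by simp
    qed
    from tendsto_diff[OF this that(1)]
    have "((\<lambda>x. of_real x / (z + of_real x - 1) - ?L z x) \<longlongrightarrow> (if z = 1 then 1 else 0) - c) (at_right 0)" .
    moreover have "eventually (\<lambda>x. of_real x / (z + of_real x - 1) - ?L z x = ?M z x) (at_right 0)"
      using eventually_at_right_less[of "0::real"]
      by eventually_elim (use that(2) in \<open>simp add: zeta_reg_logderiv algebra_simps\<close>)
    ultimately show ?thesis by (simp add: tendsto_cong)
  qed
  have "isCont zeta_reg 1" "isCont (deriv zeta_reg) 1"
  proof -
    have "zeta_reg analytic_on {1}"
      unfolding analytic_at using holomorphic_zeta_reg open_halfspace_Re_gt one(1) by blast
    thus "isCont zeta_reg 1" "isCont (deriv zeta_reg) 1"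
      by (auto intro!: analytic_at_imp_isCont analytic_deriv)
  qed
  hence L1: "(?L 1 \<longlongrightarrow> of_real 0 * (deriv zeta_reg 1 / zeta_reg 1)) (at_right 0)"
    by (intro tendsto_intros tendsto_real_at_right_complex) auto
  obtain m1 :: nat where m1: "(?L (Complex 1 t) \<longlongrightarrow> of_nat m1) (at_right 0)" "m1 = 0 \<longrightarrow> zeta_reg (Complex 1 t) \<noteq> 0"
    using lim[of "Complex 1 t"] by auto
  obtain m2 :: nat where m2: "(?L (Complex 1 (2 * t)) \<longlongrightarrow> of_nat m2) (at_right 0)"
    using lim[of "Complex 1 (2 * t)"] by auto
  have ne: "Complex 1 t \<noteq> 1" "Complex 1 (2 * t) \<noteq> 1" using False by (auto simp: complex_eq_iff)
  have "((\<lambda>x. Re (3 * ?M 1 x + 4 * ?M (Complex 1 t) x + ?M (Complex 1 (2 * t)) x)) \<longlongrightarrow>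
      Re (3 * 1 + 4 * (- of_nat m1) + (- of_nat m2))) (at_right 0)"
    using M_lim[OF L1] M_lim[OF m1(1)] M_lim[OF m2] ne
    by (intro tendsto_Re tendsto_add tendsto_mult tendsto_const) auto
  moreover have "eventually (\<lambda>x. Re (3 * ?M 1 x + 4 * ?M (Complex 1 t) x + ?M (Complex 1 (2 * t)) x) \<ge> 0) (at_right 0)"
    using eventually_at_right_less[of "0::real"]
  proof eventually_elim
    case (elim x)
    have *: "Complex 1 t + of_real x = Complex (1 + x) t" for t
      by (simp add: complex_eq_iff)
    have "3 * ?M 1 x + 4 * ?M (Complex 1 t) x + ?M (Complex 1 (2 * t)) x = of_real x *
       (3 * mangoldt_series (of_real (1 + x)) + 4 * mangoldt_series (Complex (1 + x) t) + mangoldt_series (Complex (1 + x) (2 * t)))"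
      unfolding * by (simp add: algebra_simps)
    thus ?case using three_four_one[of "1 + x" t] elim by simp
  qed
  ultimately have "Re (3 * 1 + 4 * (- of_nat m1) + (- of_nat m2)) \<ge> 0"
    by (intro tendsto_lowerbound) (auto simp: trivial_limit_at_right_real)
  hence "4 * real m1 + real m2 \<le> 3" by simp
  hence "m1 = 0" by linarith
  thus ?thesis using m1(2) by simp
qed

section \<open>Newman's Tauberian theorem\<close>

lemma powr_diff_mvt:
  fixes a b p :: real
  assumes "0 < a" "a < b"
  obtains c where "a < c" "c < b" "b powr p - a powr p = (b - a) * (p * c powr (p - 1))"
proof -
  have "((\<lambda>x. x powr p) has_real_derivative p * x powr (p - 1)) (at x)" if "a \<le> x" for x
    using that assms by (auto intro!: derivative_eq_intros)
  from MVT2[OF assms(2) this] show thesis using that by blast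
qed

text \<open>Comparison with the integral of the decreasing power, through telescoping differences of
  \<open>n powr (-x) / x\<close>. The factor \<open>1 / x\<close>, unbounded near the line, is later
  cancelled by the kernel.\<close>

lemma powr_tail_sum_le:
  assumes x: "x > 0" and N: "N > 0"
  shows "summable (\<lambda>n. real (n + Suc N) powr (-1 - x))"
    and "(\<Sum>n. real (n + Suc N) powr (-1 - x)) \<le> real N powr (-x) / x"
proof -
  show sm: "summable (\<lambda>n. real (n + Suc N) powr (-1 - x))"
    by (subst summable_iff_shift[of "\<lambda>n. real n powr (-1 - x)"]) (use x in \<open>simp add: summable_real_powr_iff\<close>)
  define u where "u = (\<lambda>n. real (n + N) powr (-x) / x)"
  have "u \<longlonglongrightarrow> 0" unfolding u_def using x by real_asymp
  hence S: "(\<lambda>n. u n - u (Suc n)) sums (u 0 - 0)" by (rule telescope_sums')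
  have "real (n + Suc N) powr (-1 - x) \<le> u n - u (Suc n)" for n
  proof -
    obtain c where c: "real (n + N) < c" "c < real (n + Suc N)"
      "real (n + Suc N) powr (-x) - real (n + N) powr (-x) = (real (n + Suc N) - real (n + N)) * (-x * c powr (-x - 1))"
      using powr_diff_mvt[of "real (n + N)" "real (n + Suc N)" "-x"] N by auto
    have "u n - u (Suc n) = - (real (n + Suc N) powr (-x) - real (n + N) powr (-x)) / x"
      by (simp add: u_def diff_divide_distrib add.assoc)
    also have "\<dots> = c powr (-x - 1)" unfolding c(3) using x by simp
    finally have "u n - u (Suc n) = c powr (-x - 1)" .
    moreover have "c powr (-x - 1) \<ge> real (n + Suc N) powr (-x - 1)"
      using c(1,2) N x by (intro powr_mono2') auto
    moreover have "- x - 1 = - 1 - x" by simp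
    ultimately show ?thesis by simp
  qed
  hence "(\<Sum>n. real (n + Suc N) powr (-1 - x)) \<le> u 0 - 0"
    using sums_le[OF _ summable_sums[OF sm] S] by simp
  thus "(\<Sum>n. real (n + Suc N) powr (-1 - x)) \<le> real N powr (-x) / x" by (simp add: u_def)
qed

text \<open>For \<open>y \<le> 1\<close> the summands decrease and the integral alone bounds the
  sum. For \<open>y > 1\<close> they increase, and the last one has to be split off; the extra term
  makes one bound fit both cases.\<close>

lemma powr_head_sum_le:
  assumes y: "y > 0" and N: "N > 0"
  shows "(\<Sum>n\<in>{0<..N}. real n powr (y - 1)) \<le> real N powr (y - 1) + real N powr y / y"
proof (cases "y \<le> 1")
  case True
  have "(\<Sum>n\<in>{0<..N}. real n powr (y - 1)) \<le> real N powr y / y" for N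
  proof (induction N)
    case (Suc N)
    have "real (Suc N) powr (y - 1) \<le> real (Suc N) powr y / y - real N powr y / y"
    proof (cases "N = 0")
      \<comment> \<open>The first summand is 1, and it is at most \<open>1 / y\<close> precisely
        because \<open>y \<le> 1\<close>.\<close>
      case True thus ?thesis using y \<open>y \<le> 1\<close> by simp
    next
      case False
      obtain c where c: "real N < c" "c < real (Suc N)"
        "real (Suc N) powr y - real N powr y = (real (Suc N) - real N) * (y * c powr (y - 1))"
        using powr_diff_mvt[of "real N" "real (Suc N)" y] False by auto
      have "real (Suc N) powr y / y - real N powr y / y = c powr (y - 1)"
        unfolding diff_divide_distrib[symmetric] c(3) using y by simp
      moreover have "c powr (y - 1) \<ge> real (Suc N) powr (y - 1)"
        using c(1,2) True False by (intro powr_mono2') auto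
      ultimately show ?thesis by simp
    qed
    moreover have "{0<..Suc N} = insert (Suc N) {0<..N}" by auto
    ultimately show ?case using Suc.IH by simp
  qed simp
  from this[of N] show ?thesis by (rule order_trans) simp
next
  case False
  have "(\<Sum>n\<in>{0<..<N}. real n powr (y - 1)) \<le> real N powr y / y" if "N > 0" for N
    using that
  proof (induction N rule: nat_induct_non_zero)
    case (Suc N)
    obtain c where c: "real N < c" "c < real (Suc N)"
      "real (Suc N) powr y - real N powr y = (real (Suc N) - real N) * (y * c powr (y - 1))"
      using powr_diff_mvt[of "real N" "real (Suc N)" y] Suc.hyps by auto
    have "real (Suc N) powr y / y - real N powr y / y = c powr (y - 1)"
      unfolding diff_divide_distrib[symmetric] c(3) using y by simp
    moreover have "c powr (y - 1) \<ge> real N powr (y - 1)"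
      using c(1,2) False by (intro powr_mono2) auto
    moreover have "{0<..<Suc N} = insert N {0<..<N}" using Suc.hyps by auto
    ultimately show ?case using Suc.IH by simp
  qed (use y in simp)
  moreover have "{0<..N} = insert N {0<..<N}" using N by auto
  ultimately show ?thesis using N by simp
qed

text \<open>Each of the two paths contributes half a turn around 0, so the winding number 1 of the
  closed path is read off from the integrals of \<open>1 / z\<close> instead of from its
  shape.\<close>

lemma Cauchy_integral_formula_two_paths:
  assumes V: "open V" "convex V" and h: "h holomorphic_on V" and z: "0 \<in> V"
    and g: "valid_path g1" "valid_path g2" "pathfinish g1 = pathstart g2" "pathfinish g2 = pathstart g1"
      "path_image g1 \<subseteq> V - {0}" "path_image g2 \<subseteq> V - {0}"
    and w: "((\<lambda>z. 1 / z) has_contour_integral (\<i> * pi)) g1" "((\<lambda>z. 1 / z) has_contour_integral (\<i> * pi)) g2"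
  shows "contour_integral g1 (\<lambda>z. h z / z) + contour_integral g2 (\<lambda>z. h z / z) = 2 * pi * \<i> * h 0"
proof -
  let ?g = "g1 +++ g2"
  have vg: "valid_path ?g" using g by auto
  have pi: "path_image ?g \<subseteq> V - {0}" using g by (auto simp: path_image_join)
  have "((\<lambda>z. 1 / z) has_contour_integral (\<i> * pi + \<i> * pi)) ?g"
    using g w by (intro has_contour_integral_join)
  hence "contour_integral ?g (\<lambda>z. 1 / (z - 0)) = 2 * pi * \<i>"
    by (simp add: contour_integral_unique)
  hence wn: "winding_number ?g 0 = 1"
    using winding_number_valid_path[OF vg, of 0] pi by auto
  have "((\<lambda>w. h w / (w - 0)) has_contour_integral (2 * pi * \<i> * winding_number ?g 0 * h 0)) ?g"
    using V z h vg pi g by (intro Cauchy_integral_formula_convex_simple) (auto simp: interior_open)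
  hence "contour_integral ?g (\<lambda>z. h z / z) = 2 * pi * \<i> * h 0"
    by (simp add: wn contour_integral_unique)
  moreover have "(\<lambda>z. h z / z) contour_integrable_on g1" "(\<lambda>z. h z / z) contour_integrable_on g2"
    using g h V by (auto intro!: contour_integrable_holomorphic_simple[of _ "V - {0}"] holomorphic_intros
       elim: holomorphic_on_subset)
  ultimately show ?thesis using g by (simp add: contour_integral_join)
qed

lemma has_contour_integral_inverse_part_circlepath:
  assumes "R > 0" "a < b"
  shows "((\<lambda>z. 1 / z) has_contour_integral (\<i> * (b - a))) (part_circlepath 0 R a b)"
proof -
  have "((\<lambda>t::real. \<i>) has_integral (b - a) *\<^sub>R \<i>) {a..b}"
    using has_integral_const_real[of \<i> a b] assms by simp
  thus ?thesis using assms
    by (subst has_contour_integral_part_circlepath_iff) (auto simp: scaleR_conv_of_real mult.commute)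
qed

text \<open>A maximum bound would not decay, since the integrand need not be small at the start of
  the segment. Integrating the exponential gains \<open>1 / c\<close>; with
  \<open>c = \<delta> * ln N\<close> this is the source of the factor
  \<open>1 / ln N\<close>.\<close>

lemma contour_integral_linepath_exp_bound:
  assumes f: "f contour_integrable_on linepath a b" and c: "c > 0"
    and B: "\<And>u. u \<in> {0..1} \<Longrightarrow> norm (f (linepath a b u)) \<le> B * exp (- c * u)"
  shows "norm (contour_integral (linepath a b) f) \<le> B * norm (b - a) / c"
proof -
  have B0: "B \<ge> 0" using order_trans[OF norm_ge_zero B[of 0]] by simp
  have "((\<lambda>u. - (B * norm (b - a)) / c * exp (- c * u)) has_vector_derivative B * norm (b - a) * exp (- c * u)) (at u within {0..1})" for u
    unfolding has_real_derivative_iff_has_vector_derivative[symmetric]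
    using c by (auto intro!: derivative_eq_intros)
  hence I: "((\<lambda>u. B * norm (b - a) * exp (- c * u)) has_integral
      (- (B * norm (b - a)) / c * exp (- c * 1) - - (B * norm (b - a)) / c * exp (- c * 0))) {0..1}"
    by (intro fundamental_theorem_of_calculus) auto
  have "((\<lambda>x. f (linepath a b x) * (b - a)) has_integral contour_integral (linepath a b) f) {0..1}"
    using has_contour_integral_integral[OF f] unfolding has_contour_integral_linepath .
  moreover have "norm (f (linepath a b x) * (b - a)) \<le> B * norm (b - a) * exp (- c * x)" if "x \<in> {0..1}" for x
    using mult_right_mono[OF B[OF that], of "norm (b - a)"] by (simp add: norm_mult mult_ac)
  ultimately have "norm (contour_integral (linepath a b) f) \<le>
      - (B * norm (b - a)) / c * exp (- c * 1) - - (B * norm (b - a)) / c * exp (- c * 0)"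
    using integral_norm_bound_integral[of "\<lambda>x. f (linepath a b x) * (b - a)" "{0..1}" "\<lambda>u. B * norm (b - a) * exp (- c * u)"] I
    by (metis (no_types, lifting) has_integral_integrable integral_unique)
  also have "\<dots> \<le> B * norm (b - a) / c" using B0 c by (simp add: field_simps)
  finally show ?thesis .
qed

text \<open>On the circle R^2 = z cnj z, hence 1/z + z/R^2 is a multiple of z + cnj z. The factor
  \<open>Re z\<close> obtained here cancels the \<open>1 / Re z\<close> in the bounds for tail and
  partial sum, which is the purpose of the term z^2/R^2.\<close>

lemma newman_kernel_circle:
  assumes "norm z = R" "R > 0"
  shows "(1 + z\<^sup>2 / of_real (R\<^sup>2)) / z = of_real (2 * Re z / R\<^sup>2)"
proof -
  have z: "z \<noteq> 0" using assms by auto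
  have "of_real (R\<^sup>2) = z * cnj z" using assms complex_norm_square[of z] by simp
  hence "(1 + z\<^sup>2 / of_real (R\<^sup>2)) / z = (z + cnj z) / of_real (R\<^sup>2)"
    using z by (simp add: field_simps power2_eq_square)
  thus ?thesis by (simp add: complex_add_cnj)
qed

text \<open>Cauchy's formula for \<open>F\<close> is applied to the right half of the circle of radius \<open>R\<close> closed by
  the segments from \<open>\<i> R\<close> through \<open>-\<delta>\<close> to \<open>-\<i> R\<close>, and for the partial sum \<open>S\<close>, which is entire, to the
  full circle. With the kernel \<open>N powr z * (1 + z\<^sup>2 / R\<^sup>2) / z\<close> the two half circles contribute
  \<open>O(1/R + 1/N)\<close> and the segments \<open>O(1 / ln N)\<close> for fixed \<open>R\<close>.\<close>

theorem newman_tauberian: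
  fixes a :: "nat \<Rightarrow> complex" and F :: "complex \<Rightarrow> complex"
  assumes bnd: "\<And>n. n > 0 \<Longrightarrow> norm (a n) \<le> C"
    and hol: "F holomorphic_on U" and U: "open U" "{s. Re s \<ge> 1} \<subseteq> U"
    and F: "\<And>s. Re s > 1 \<Longrightarrow> (\<lambda>n. a n * of_nat n powr (-s)) sums F s"
  shows "(\<lambda>N. \<Sum>n\<in>{0<..N}. a n / of_nat n) \<longlonglongrightarrow> F 1"
proof -
  have C: "C \<ge> 0" using order_trans[OF norm_ge_zero bnd[of 1]] by simp
  have inU: "1 + z \<in> U" if "Re z \<ge> 0" for z
    using U(2) that by (simp add: subset_iff)
  define S where "S = (\<lambda>N z. \<Sum>n\<in>{0<..N}. a n * of_nat n powr (-1 - z))"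
  have S0: "S N 0 = (\<Sum>n\<in>{0<..N}. a n / of_nat n)" for N
    unfolding S_def by (intro sum.cong) (auto simp: powr_minus field_simps)
  have holS: "S N holomorphic_on A" for N A
    unfolding S_def by (intro holomorphic_intros) auto
  have tail: "norm (F (1 + z) - S N z) \<le> C * (real N powr (- Re z) / Re z)" if z: "Re z > 0" and N: "N > 0" for z N
  proof -
    let ?t = "\<lambda>n. a n * of_nat n powr (- (1 + z))"
    have "(\<Sum>n<Suc N. ?t n) = S N z"
      unfolding S_def
      by (intro sum.mono_neutral_cong_right) auto
    hence sm: "(\<lambda>n. ?t (n + Suc N)) sums (F (1 + z) - S N z)"
      using sums_split_initial_segment[OF F[of "1 + z"], of "Suc N"] z by simp
    have le: "norm (?t (n + Suc N)) \<le> C * real (n + Suc N) powr (-1 - Re z)" for n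
      using bnd[of "n + Suc N"] C
      by (auto simp: norm_mult norm_of_nat_powr simp del: of_nat_Suc of_nat_add intro!: mult_right_mono)
    have "norm (F (1 + z) - S N z) \<le> (\<Sum>n. C * real (n + Suc N) powr (-1 - Re z))"
      using norm_sums_le[OF sm summable_sums[OF summable_mult[OF powr_tail_sum_le(1)[OF z N]]] le] .
    also have "\<dots> = C * (\<Sum>n. real (n + Suc N) powr (-1 - Re z))"
      by (rule suminf_mult[OF powr_tail_sum_le(1)[OF z N]])
    also have "\<dots> \<le> C * (real N powr (- Re z) / Re z)"
      by (rule mult_left_mono[OF powr_tail_sum_le(2)[OF z N] C])
    finally show ?thesis .
  qed
  have head: "norm (S N z) \<le> C * (real N powr (- Re z - 1) + real N powr (- Re z) / (- Re z))"
    if z: "Re z < 0" and N: "N > 0" for z N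
  proof -
    have eq: "- Re z - 1 = - 1 - Re z" by simp
    have "norm (S N z) \<le> (\<Sum>n\<in>{0<..N}. C * real n powr (- 1 - Re z))"
      unfolding S_def using bnd
      by (intro sum_norm_le) (auto simp: norm_mult norm_of_nat_powr intro!: mult_right_mono)
    also have "\<dots> \<le> C * (real N powr (- Re z - 1) + real N powr (- Re z) / (- Re z))"
      unfolding sum_distrib_left[symmetric] eq
      using powr_head_sum_le[of "- Re z" N, unfolded eq] z N C by (intro mult_left_mono) auto
    finally show ?thesis .
  qed
  have "eventually (\<lambda>N. norm (F 1 - S N 0) < \<epsilon>) sequentially" if \<epsilon>: "\<epsilon> > 0" for \<epsilon> :: real
  proof -
    \<comment> \<open>As \<open>N\<close> grows, the two half circles leave a bound
      \<open>2 * C / R\<close>, which this choice keeps below \<open>\<epsilon>\<close>; the summand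
      1 keeps \<open>R\<close> positive also for \<open>C = 0\<close>.\<close>
    define R where "R = 1 + 4 * C / \<epsilon>"
    have R: "R \<ge> 1" "R > 0" "2 * C / R < \<epsilon>"
      using C \<epsilon> by (auto simp: R_def field_simps add_nonneg_pos add_pos_nonneg)
    \<comment> \<open>The domain \<open>U\<close> may become arbitrarily thin to the left of the
      line at large height. Compactness of the half disc gives a strip of uniform width, depending
      on \<open>R\<close>.\<close>
    obtain e where e: "e > 0" "\<And>z. Re z > - e \<Longrightarrow> norm z < R + 1 \<Longrightarrow> 1 + z \<in> U"
    proof -
      define K where "K = cball 0 (R + 1) \<inter> {z. Re z \<ge> 0}"
      have "compact K" unfolding K_def by (intro compact_Int_closed compact_cball closed_halfspace_Re_ge)
      moreover have "open ((\<lambda>z. 1 + z) -` U)" using U(1) by (intro open_vimage continuous_intros)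
      moreover have "K \<subseteq> (\<lambda>z. 1 + z) -` U" using inU by (auto simp: K_def)
      ultimately obtain e where e: "0 < e" "(\<Union>x\<in>K. ball x e) \<subseteq> (\<lambda>z. 1 + z) -` U"
        using compact_subset_open_imp_ball_epsilon_subset by metis
      have "1 + z \<in> U" if z: "Re z > - e" "norm z < R + 1" for z
      proof (cases "Re z \<ge> 0")
        case True thus ?thesis by (rule inU)
      next
        case False
        have "Complex 0 (Im z) \<in> K"
          using z(2) abs_Im_le_cmod[of z] by (auto simp: K_def complex_norm)
        moreover have "Complex 0 (Im z) - z = of_real (- Re z)" by (simp add: complex_eq_iff)
        hence "dist (Complex 0 (Im z)) z = \<bar>Re z\<bar>" unfolding dist_norm by simp
        hence "z \<in> ball (Complex 0 (Im z)) e" using z False by simp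
        ultimately show ?thesis using e(2) by blast
      qed
      with e(1) show thesis by (rule that)
    qed
    define V where "V = {z. Re z > - e} \<inter> ball 0 (R + 1)"
    have V: "open V" "convex V" "0 \<in> V"
      using e R by (auto simp: V_def open_halfspace_Re_gt convex_halfspace_Re_gt intro!: open_Int convex_Int)
    have FV: "(\<lambda>z. F (1 + z)) holomorphic_on V"
    proof -
      have "F \<circ> (\<lambda>z. 1 + z) holomorphic_on V"
        by (rule holomorphic_on_compose_gen[OF _ hol]) (use e(2) in \<open>auto simp: V_def intro!: holomorphic_intros\<close>)
      thus ?thesis by (simp add: o_def)
    qed
    \<comment> \<open>Half of \<open>e\<close> keeps \<open>-\<delta>\<close> inside the strip, and
      the cap \<open>1 / 2\<close> keeps it inside the disc, so that the convex set \<open>V\<close>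
      contains both segments.\<close>
    define \<delta> where "\<delta> = min (e / 2) (1 / 2)"
    have \<delta>: "\<delta> > 0" "\<delta> < e" "\<delta> < R + 1" using e R by (auto simp: \<delta>_def)
    define Lp where "Lp = linepath (\<i> * of_real R) (- of_real \<delta>) +++ linepath (- of_real \<delta>) (- (\<i> * of_real R))"
    define Cr where "Cr = part_circlepath 0 R (-(pi/2)) (pi/2)"
    define Cl where "Cl = part_circlepath 0 R (pi/2) (3 * pi / 2)"
    have exps: "exp (\<i> * of_real (pi/2)) = \<i>" "exp (\<i> * of_real (-(pi/2))) = - \<i>" "exp (\<i> * of_real (3 * pi/2)) = -\<i>"
      using cos_3over2_pi sin_3over2_pi unfolding cis_conv_exp[symmetric]
      by (auto simp: complex_eq_iff simp del: cos_3over2_pi sin_3over2_pi)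
    note [simp] = exps
    have valid: "valid_path Lp" "valid_path Cr" "valid_path Cl" by (auto simp: Lp_def Cr_def Cl_def)
    have ends: "pathfinish Cr = pathstart Lp" "pathfinish Lp = pathstart Cr"
        "pathfinish Cr = pathstart Cl" "pathfinish Cl = pathstart Cr"
      by (simp_all only: Lp_def Cr_def Cl_def pathstart_part_circlepath pathfinish_part_circlepath exps
            pathstart_join pathfinish_join pathstart_linepath pathfinish_linepath) (auto simp: mult.commute)
    have inC: "norm z = R" if "z \<in> path_image Cr \<or> z \<in> path_image Cl" for z
      using that in_path_image_part_circlepath[of z 0 R] R by (auto simp: Cr_def Cl_def)
    have ReC: "Re z \<ge> 0" if "z \<in> path_image Cr" for z
      using that R by (auto simp: Cr_def path_image_part_circlepath' closed_segment_eq_real_ivl cos_ge_zero)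
    have ReCl: "Re z \<le> 0" if "z \<in> path_image Cl" for z
    proof -
      have "z \<in> (\<lambda>x. 0 + of_real R * cis x) ` {pi/2..3*pi/2}"
        using that by (simp add: Cl_def path_image_part_circlepath' closed_segment_eq_real_ivl)
      then obtain x where "z = 0 + of_real R * cis x" "x \<in> {pi/2..3*pi/2}" by (rule imageE)
      hence x: "z = of_real R * cis x" "pi/2 \<le> x" "x \<le> 3*pi/2" by auto
      have "cos (x - pi) \<ge> 0" using x by (intro cos_ge_zero) auto
      hence "cos x \<le> 0" by (simp add: cos_diff)
      thus ?thesis using x R by (simp add: mult_nonneg_nonpos)
    qed
    have seg: "z \<in> V" if "z \<in> closed_segment (\<i> * of_real R) (- of_real \<delta>) \<union> closed_segment (- of_real \<delta>) (- (\<i> * of_real R))" for z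
    proof -
      have "\<i> * of_real R \<in> V" "- of_real \<delta> \<in> V" "- (\<i> * of_real R) \<in> V"
        using \<delta> R e by (auto simp: V_def norm_mult)
      thus ?thesis using that closed_segment_subset[OF _ _ V(2)] by blast
    qed
    have segRe: "z = \<i> * of_real R \<or> z = - (\<i> * of_real R) \<or> Re z < 0"
      if "z \<in> closed_segment (\<i> * of_real R) (- of_real \<delta>) \<union> closed_segment (- of_real \<delta>) (- (\<i> * of_real R))" for z
    proof -
      from that consider u where "u \<in> {0..1}" "z = (1 - u) *\<^sub>R (\<i> * of_real R) + u *\<^sub>R (- of_real \<delta>)"
        | u where "u \<in> {0..1}" "z = (1 - u) *\<^sub>R (- of_real \<delta>) + u *\<^sub>R (- (\<i> * of_real R))"
        by (auto simp: closed_segment_def)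
      thus ?thesis
      proof cases
        case 1 thus ?thesis using \<delta>(1) by (cases "u = 0") auto
      next
        case 2 thus ?thesis using \<delta>(1) by (cases "u = 1") (auto simp: mult_neg_pos)
      qed
    qed
    have piL: "path_image Lp = closed_segment (\<i> * of_real R) (- of_real \<delta>) \<union> closed_segment (- of_real \<delta>) (- (\<i> * of_real R))"
      unfolding Lp_def by (subst path_image_join) auto
    have imgL: "path_image Lp \<subseteq> V - {0}"
      unfolding piL using seg segRe R by fastforce
    have imgC: "path_image Cr \<subseteq> V - {0}" "path_image Cr \<subseteq> UNIV - {0}" "path_image Cl \<subseteq> UNIV - {0}"
      using inC ReC e R by (fastforce simp: V_def)+
    have wL: "((\<lambda>z. 1 / z) has_contour_integral (\<i> * pi)) Lp"
    proof -
      \<comment> \<open>The primitive \<open>Ln (- z)\<close> has its cut along the nonnegative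
        reals, which the path passes on the left.\<close>
      have "((\<lambda>z. 1 / z) has_contour_integral (Ln (- pathfinish Lp) - Ln (- pathstart Lp))) Lp"
      proof (rule contour_integral_primitive[OF _ valid(1) order_refl])
        fix z assume "z \<in> path_image Lp"
        with segRe[of z] R have "- z \<notin> \<real>\<^sub>\<le>\<^sub>0" "z \<noteq> 0" unfolding piL by (auto simp: complex_nonpos_Reals_iff)
        thus "((\<lambda>z. Ln (- z)) has_field_derivative 1 / z) (at z within path_image Lp)"
          by (auto intro!: derivative_eq_intros simp: divide_simps)
      qed
      moreover have "Ln (\<i> * of_real R) - Ln (- (\<i> * of_real R)) = \<i> * pi"
        using R Ln_times_of_real[of R \<i>] Ln_times_of_real[of R "-\<i>"] by (simp add: mult.commute)
      ultimately show ?thesis by (simp add: Lp_def)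
    qed
    have wC: "((\<lambda>z. 1 / z) has_contour_integral (\<i> * pi)) Cr" "((\<lambda>z. 1 / z) has_contour_integral (\<i> * pi)) Cl"
      using has_contour_integral_inverse_part_circlepath[of R "-(pi/2)" "pi/2"]
        has_contour_integral_inverse_part_circlepath[of R "pi/2" "3*pi/2"] R
      by (simp_all add: Cr_def Cl_def algebra_simps)
    define k where "k = (\<lambda>z::complex. 1 + z\<^sup>2 / of_real (R\<^sup>2))"
    \<comment> \<open>The factor \<open>of_nat N powr z\<close> is left out, so that the resulting
      bound \<open>B\<close> is independent of \<open>N\<close>.\<close>
    have "continuous_on (path_image Lp) (\<lambda>z. F (1 + z) * k z / z)"
    proof -
      have "(\<lambda>z. F (1 + z)) holomorphic_on path_image Lp" using FV imgL by (auto elim: holomorphic_on_subset)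
      thus ?thesis using imgL unfolding k_def
        by (intro holomorphic_on_imp_continuous_on holomorphic_intros) auto
    qed
    moreover have "compact (path_image Lp)" using valid(1) by (simp add: compact_valid_path_image)
    ultimately have "compact ((\<lambda>z. F (1 + z) * k z / z) ` path_image Lp)" by (rule compact_continuous_image)
    then obtain B where B: "B > 0" "\<And>z. z \<in> path_image Lp \<Longrightarrow> norm (F (1 + z) * k z / z) \<le> B"
      by (auto dest!: compact_imp_bounded simp: bounded_pos)
    define k' where "k' = (\<lambda>N z. of_nat N powr z * k z)"
    have holk: "k' N holomorphic_on A" if "N > 0" for N A
      unfolding k'_def k_def using that by (intro holomorphic_intros) auto
    have norm_k': "norm (k' N z / z) = real N powr Re z * (2 * \<bar>Re z\<bar> / R\<^sup>2)" if "norm z = R" for N z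
    proof -
      have "k' N z / z = of_nat N powr z * of_real (2 * Re z / R\<^sup>2)"
        unfolding newman_kernel_circle[OF that R(2), symmetric] by (simp add: k'_def k_def)
      hence "norm (k' N z / z) = real N powr Re z * \<bar>2 * Re z / R\<^sup>2\<bar>"
        by (simp only: norm_mult norm_of_real norm_of_nat_powr)
      thus ?thesis by (simp add: abs_mult)
    qed
    have Re_pos: "Re z \<noteq> 0" if "norm z = R" "z \<notin> {\<i> * of_real R, - (\<i> * of_real R)}" for z
    proof
      assume "Re z = 0"
      hence "\<bar>Im z\<bar> = R" using that(1) by (simp add: cmod_def)
      thus False using that(2) \<open>Re z = 0\<close> by (auto simp: complex_eq_iff abs_if split: if_splits)
    qed
    \<comment> \<open>The length of \<open>Lp\<close>.\<close>
    define \<Lambda> where "\<Lambda> = norm (- of_real \<delta> - \<i> * of_real R) + norm (- of_real \<delta> + \<i> * of_real R)"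
    have main: "norm (F 1 - S N 0) \<le> 2 * C / R + C / N + B * \<Lambda> / (2 * pi * \<delta>) / ln N" if N: "N \<ge> 2" for N :: nat
    proof -
      have N0: "N > 0" using N by simp
      let ?hF = "\<lambda>z. F (1 + z) * k' N z" and ?hS = "\<lambda>z. S N z * k' N z"
      have h: "?hF holomorphic_on V" "?hS holomorphic_on A" for A
        using FV holS holk[OF N0] by (auto intro!: holomorphic_intros)
      have I1: "contour_integral Cr (\<lambda>z. ?hF z / z) + contour_integral Lp (\<lambda>z. ?hF z / z) = 2 * pi * \<i> * F 1"
        using Cauchy_integral_formula_two_paths[OF V(1,2) h(1) V(3) valid(2,1) ends(1,2) imgC(1) imgL wC(1) wL] N0
        by (simp add: k'_def k_def)
      have I2: "contour_integral Cr (\<lambda>z. ?hS z / z) + contour_integral Cl (\<lambda>z. ?hS z / z) = 2 * pi * \<i> * S N 0"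
        using Cauchy_integral_formula_two_paths[OF open_UNIV convex_UNIV h(2) UNIV_I valid(2,3) ends(3,4) imgC(2,3) wC] N0
        by (simp add: k'_def k_def)
      have int: "(\<lambda>z. ?hF z / z) contour_integrable_on g" if "valid_path g" "path_image g \<subseteq> V - {0}" for g
        using that V(1)
        by (intro contour_integrable_holomorphic_simple[of _ "V - {0}"]
              holomorphic_on_divide holomorphic_on_subset[OF h(1)] holomorphic_on_ident) auto
      have intS: "(\<lambda>z. ?hS z / z) contour_integrable_on g" if "valid_path g" "path_image g \<subseteq> UNIV - {0}" for g
        using that
        by (intro contour_integrable_holomorphic_simple[of _ "UNIV - {0}"]
              holomorphic_on_divide h(2) holomorphic_on_ident) auto
      \<comment> \<open>At the two endpoints of the arcs \<open>Re z = 0\<close> and the bounds with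
        \<open>1 / Re z\<close> say nothing; a finite exceptional set does not affect the
        integral.\<close>
      let ?E = "{\<i> * complex_of_real R, - (\<i> * of_real R)}"
      have bC: "norm (contour_integral Cr (\<lambda>z. ?hF z / z - ?hS z / z)) \<le> (2 * C / R\<^sup>2) * R * (pi / 2 - -(pi / 2))"
        unfolding Cr_def
      proof (rule contour_integral_bound_part_circlepath_strong[where k = ?E], goal_cases)
        case 1 show ?case
          using contour_integrable_diff[OF int[OF valid(2) imgC(1)] intS[OF valid(2) imgC(2)]] by (simp add: Cr_def)
      next
        case (6 z)
        hence z: "norm z = R" "Re z > 0" using inC[of z] ReC[of z] Re_pos[of z] by (auto simp: Cr_def)
        have "norm (?hF z / z - ?hS z / z) = norm (F (1 + z) - S N z) * norm (k' N z / z)"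
          unfolding norm_mult[symmetric] by (simp add: diff_divide_distrib ring_distribs)
        also have "\<dots> \<le> C * (real N powr (- Re z) / Re z) * (real N powr Re z * (2 * \<bar>Re z\<bar> / R\<^sup>2))"
          unfolding norm_k'[OF z(1)] by (intro mult_right_mono tail[OF z(2) N0]) auto
        also have "\<dots> = 2 * C / R\<^sup>2 * (real N powr (- Re z) * real N powr Re z)"
          using z(2) by (simp add: field_simps)
        also have "real N powr (- Re z) * real N powr Re z = 1" using N0 by (simp flip: powr_add)
        finally show ?case by simp
      qed (use C R in auto)
      have bL: "norm (contour_integral Cl (\<lambda>z. ?hS z / z)) \<le> (2 * C * (1 / (N * R) + 1 / R\<^sup>2)) * R * (3 * pi / 2 - pi / 2)"
        unfolding Cl_def
      proof (rule contour_integral_bound_part_circlepath_strong[where k = ?E], goal_cases)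
        case 1 show ?case
          using intS[OF valid(3) imgC(3)] by (simp add: Cl_def)
      next
        case (6 z)
        hence z: "norm z = R" "Re z < 0" using inC[of z] ReCl[of z] Re_pos[of z] by (auto simp: Cl_def)
        have pw: "real N powr (- Re z - 1) = real N powr (- Re z) / N" using N0 by (simp add: powr_diff)
        have x: "\<bar>Re z\<bar> \<le> R" using abs_Re_le_cmod[of z] z by simp
        have "norm (?hS z / z) = norm (S N z) * norm (k' N z / z)"
          unfolding norm_mult[symmetric] by simp
        also have "\<dots> \<le> C * (real N powr (- Re z - 1) + real N powr (- Re z) / (- Re z)) * (real N powr Re z * (2 * \<bar>Re z\<bar> / R\<^sup>2))"
          unfolding norm_k'[OF z(1)] by (intro mult_right_mono head[OF z(2) N0]) auto
        also have "\<dots> = 2 * C * (\<bar>Re z\<bar> / (N * R\<^sup>2) + 1 / R\<^sup>2) * (real N powr (- Re z) * real N powr Re z)"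
        proof -
          have "C * (P / M + P / y) * (Q * (2 * y / r)) = 2 * C * (y / (M * r) + 1 / r) * (P * Q)"
            if "y > 0" "M > 0" "r > 0" for P M y Q r :: real
            using that by (simp add: field_simps)
          from this[of "- Re z" N "R\<^sup>2"] show ?thesis unfolding pw using z(2) N0 R by simp
        qed
        also have "real N powr (- Re z) * real N powr Re z = 1" using N0 by (simp flip: powr_add)
        also have "2 * C * (\<bar>Re z\<bar> / (N * R\<^sup>2) + 1 / R\<^sup>2) * 1 \<le> 2 * C * (R / (N * R\<^sup>2) + 1 / R\<^sup>2)"
          unfolding mult_1_right using x C by (intro mult_left_mono add_right_mono divide_right_mono) auto
        also have "R / (N * R\<^sup>2) = 1 / (N * R)" using R by (simp add: power2_eq_square)
        finally show ?case .
      qed (use C R in auto)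
      have bS: "norm (contour_integral (linepath b (- of_real \<delta>)) (\<lambda>z. ?hF z / z)) \<le> B * norm (- of_real \<delta> - b) / (\<delta> * ln N)"
        if b: "Re b = 0" "closed_segment b (- of_real \<delta>) \<subseteq> path_image Lp" for b
      proof (rule contour_integral_linepath_exp_bound)
        show "(\<lambda>z. ?hF z / z) contour_integrable_on linepath b (- of_real \<delta>)"
          using b imgL by (intro int) auto
        show "\<delta> * ln (real N) > 0" using \<delta> N by simp
        fix u :: real assume u: "u \<in> {0..1}"
        define z where "z = linepath b (- of_real \<delta>) u"
        have "z \<in> path_image (linepath b (- of_real \<delta>))" using u unfolding z_def path_image_def by blast
        hence z: "z \<in> path_image Lp" using b by auto
        have "Re z = - \<delta> * u" using b by (simp add: z_def linepath_def)
        hence "norm (of_nat N powr z :: complex) = exp (- (\<delta> * ln (real N)) * u)"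
          using N0 by (simp add: norm_of_nat_powr powr_def mult_ac)
        moreover have "?hF z / z = (F (1 + z) * k z / z) * of_nat N powr z" by (simp add: k'_def)
        ultimately show "norm (?hF z / z) \<le> B * exp (- (\<delta> * ln (real N)) * u)"
          using B(2)[OF z] by (simp only: norm_mult mult_right_mono exp_ge_zero)
      qed
      let ?l1 = "linepath (\<i> * of_real R) (- complex_of_real \<delta>)" and ?l2 = "linepath (- complex_of_real \<delta>) (- (\<i> * of_real R))"
      have "contour_integral Lp (\<lambda>z. ?hF z / z) = contour_integral ?l1 (\<lambda>z. ?hF z / z) + contour_integral ?l2 (\<lambda>z. ?hF z / z)"
        unfolding Lp_def using imgL by (intro contour_integral_join int) (auto simp: piL)
      \<comment> \<open>Reversed, the second segment also runs from the imaginary axis to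
        \<open>-\<delta>\<close>, the direction in which \<open>bS\<close> measures the
        decay.\<close>
      also have "contour_integral ?l2 (\<lambda>z. ?hF z / z) = - contour_integral (linepath (- (\<i> * of_real R)) (- complex_of_real \<delta>)) (\<lambda>z. ?hF z / z)"
        by (subst contour_integral_reversepath[symmetric]) auto
      finally have "norm (contour_integral Lp (\<lambda>z. ?hF z / z)) \<le>
         B * norm (- of_real \<delta> - \<i> * of_real R) / (\<delta> * ln N) + B * norm (- of_real \<delta> - (- (\<i> * of_real R))) / (\<delta> * ln N)"
        using norm_triangle_le_diff[OF add_mono[OF bS[of "\<i> * of_real R"] bS[of "- (\<i> * of_real R)"]]]
        by (auto simp: piL closed_segment_commute)
      also have "\<dots> = B * \<Lambda> / (\<delta> * ln N)" by (simp add: \<Lambda>_def ring_distribs add_divide_distrib)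
      finally have bLp: "norm (contour_integral Lp (\<lambda>z. ?hF z / z)) \<le> B * \<Lambda> / (\<delta> * ln N)" .
      have diff: "contour_integral Cr (\<lambda>z. ?hF z / z - ?hS z / z) = contour_integral Cr (\<lambda>z. ?hF z / z) - contour_integral Cr (\<lambda>z. ?hS z / z)"
        by (rule contour_integral_diff[OF int[OF valid(2) imgC(1)] intS[OF valid(2) imgC(2)]])
      \<comment> \<open>The function and its partial sum are compared on the right arc, where their
        difference is a small tail; to the left each is estimated separately, on its own
        path.\<close>
      have "2 * pi * \<i> * (F 1 - S N 0) = contour_integral Cr (\<lambda>z. ?hF z / z - ?hS z / z)
             + contour_integral Lp (\<lambda>z. ?hF z / z) - contour_integral Cl (\<lambda>z. ?hS z / z)"
        unfolding right_diff_distrib I1[symmetric] I2[symmetric] diff by (simp only: algebra_simps)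
      hence "norm (2 * pi * \<i> * (F 1 - S N 0)) \<le> (2 * C / R\<^sup>2) * R * (pi / 2 - -(pi / 2))
         + B * \<Lambda> / (\<delta> * ln N) + (2 * C * (1 / (N * R) + 1 / R\<^sup>2)) * R * (3 * pi / 2 - pi / 2)"
        using norm_triangle_le_diff[OF add_mono[OF norm_triangle_le[OF add_mono[OF bC bLp]] bL]] by simp
      also have "norm (2 * pi * \<i> * (F 1 - S N 0)) = 2 * pi * norm (F 1 - S N 0)" by (simp add: norm_mult)
      finally have "norm (F 1 - S N 0) \<le> ((2 * C / R\<^sup>2) * R * (pi / 2 - -(pi / 2))
         + B * \<Lambda> / (\<delta> * ln N) + (2 * C * (1 / (N * R) + 1 / R\<^sup>2)) * R * (3 * pi / 2 - pi / 2)) / (2 * pi)"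
        by (simp add: field_simps)
      also have "\<dots> = (2 * (C / R) * pi + B * \<Lambda> / (\<delta> * ln N) + 2 * (C / N + C / R) * pi) / (2 * pi)"
      proof -
        have "(2 * C / R\<^sup>2) * R * (pi / 2 - -(pi / 2)) = 2 * (C / R) * pi"
          using R by (simp add: power2_eq_square)
        moreover have "(1 / (N * R) + 1 / R\<^sup>2) * R = 1 / N + 1 / R"
          using R by (simp add: distrib_right power2_eq_square)
        hence "(2 * C * (1 / (N * R) + 1 / R\<^sup>2)) * R * (3 * pi / 2 - pi / 2) = 2 * C * (1 / N + 1 / R) * pi"
          by (simp add: mult.assoc)
        ultimately show ?thesis by (simp add: distrib_left)
      qed
      also have "\<dots> = C / R + B * \<Lambda> / (2 * pi * \<delta>) / ln N + (C / N + C / R)"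
        by (simp add: add_divide_distrib mult_ac)
      also have "\<dots> = 2 * C / R + C / N + B * \<Lambda> / (2 * pi * \<delta>) / ln N" by simp
      finally show ?thesis .
    qed
    have "(\<lambda>N. 2 * C / R + C / N + B * \<Lambda> / (2 * pi * \<delta>) / ln N) \<longlonglongrightarrow> 2 * C / R + 0 + 0"
      by (intro tendsto_add tendsto_const) real_asymp+
    hence "eventually (\<lambda>N::nat. 2 * C / R + C / N + B * \<Lambda> / (2 * pi * \<delta>) / ln N < \<epsilon>) sequentially"
      by (rule order_tendstoD) (use R in simp)
    thus ?thesis using eventually_ge_at_top[of 2]
      by eventually_elim (use main in \<open>auto intro: le_less_trans\<close>)
  qed
  hence "(\<lambda>N. S N 0) \<longlonglongrightarrow> F 1" unfolding tendsto_iff dist_norm by (simp add: norm_minus_commute)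
  thus ?thesis by (simp add: S0)
qed

section \<open>Chebyshev's function and the prime number theorem\<close>

definition chebyshev_psi :: "nat \<Rightarrow> real" where
  "chebyshev_psi n = (\<Sum>k\<in>{0<..n}. mangoldt k)"

lemma chebyshev_psi_mono: "m \<le> n \<Longrightarrow> chebyshev_psi m \<le> chebyshev_psi n"
  unfolding chebyshev_psi_def by (intro sum_mono2) (auto simp: mangoldt_nonneg)

lemma chebyshev_psi_nonneg: "chebyshev_psi n \<ge> 0"
  unfolding chebyshev_psi_def by (intro sum_nonneg) (auto simp: mangoldt_nonneg)

text \<open>Legendre's formula. From \<open>N\<close> to \<open>Suc N\<close> the quotient
  \<open>N div d\<close> grows by one exactly for the divisors of \<open>Suc N\<close>, whose
  \<open>mangoldt\<close> values add up to \<open>ln (Suc N)\<close>.\<close>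

lemma ln_fact_conv_mangoldt:
  "ln (fact N) = (\<Sum>d\<in>{0<..N}. mangoldt d * real (N div d))"
proof (induction N)
  case (Suc N)
  have "(\<Sum>d\<in>{0<..Suc N}. mangoldt d * real (Suc N div d)) =
     (\<Sum>d\<in>{0<..Suc N}. mangoldt d * real (N div d) + (if d dvd Suc N then mangoldt d else 0))"
    by (intro sum.cong) (auto simp: div_Suc algebra_simps mod_eq_0_iff_dvd)
  also have "\<dots> = (\<Sum>d\<in>{0<..Suc N}. mangoldt d * real (N div d)) + (\<Sum>d\<in>{0<..Suc N}. if d dvd Suc N then mangoldt d else 0)"
    by (rule sum.distrib)
  also have "(\<Sum>d\<in>{0<..Suc N}. mangoldt d * real (N div d)) = (\<Sum>d\<in>{0<..N}. mangoldt d * real (N div d))"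
    by (intro sum.mono_neutral_right) auto
  also have "(\<Sum>d\<in>{0<..Suc N}. if d dvd Suc N then mangoldt d else 0) = (\<Sum>d | d dvd Suc N. mangoldt d)"
    by (intro sum.mono_neutral_cong_right) (auto intro: dvd_pos_nat[of "Suc N"] dvd_imp_le[OF _ zero_less_Suc])
  also have "\<dots> = ln (real (Suc N))" by (subst mangoldt_sum) auto
  also have "(\<Sum>d\<in>{0<..N}. mangoldt d * real (N div d)) + ln (real (Suc N)) = ln (fact (Suc N))"
    unfolding Suc.IH[symmetric] by (simp add: ln_mult del: of_nat_Suc)
  finally show ?case by simp
qed simp

text \<open>In the logarithm of the central binomial coefficient, \<open>mangoldt d\<close> has the
  weight \<open>2 * N div d - 2 * (N div d)\<close>, which is never negative and at least 1 for
  \<open>N < d \<le> 2 * N\<close>. The coefficient itself is at most 2^(2N).\<close>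

lemma chebyshev_psi_double: "chebyshev_psi (2 * N) - chebyshev_psi N \<le> 2 * N * ln 2"
proof -
  have "chebyshev_psi (2 * N) = chebyshev_psi N + (\<Sum>d\<in>{N<..2*N}. mangoldt d)"
    unfolding chebyshev_psi_def by (subst sum.union_disjoint[symmetric]) (auto intro!: sum.cong)
  hence "chebyshev_psi (2 * N) - chebyshev_psi N = (\<Sum>d\<in>{N<..2*N}. mangoldt d)" by simp
  also have "\<dots> = (\<Sum>d\<in>{0<..2*N}. if N < d then mangoldt d else 0)"
    by (intro sum.mono_neutral_cong_left) auto
  also have "\<dots> \<le> (\<Sum>d\<in>{0<..2*N}. mangoldt d * (real (2 * N div d) - 2 * real (N div d)))"
  proof (rule sum_mono)
    fix d assume d: "d \<in> {0<..2*N}"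
    show "(if N < d then mangoldt d else 0) \<le> mangoldt d * (real (2 * N div d) - 2 * real (N div d))"
    proof (cases "N < d")
      case True
      hence "2 * N div d \<ge> 1" "N div d = 0" using d by (auto simp: Suc_le_eq div_greater_zero_iff)
      hence "real (2 * N div d) - 2 * real (N div d) \<ge> 1" by simp
      from mult_left_mono[OF this mangoldt_nonneg[of d]] show ?thesis using True by simp
    next
      case False
      have "2 * (N div d) \<le> 2 * N div d"
        using d div_times_less_eq_dividend[of N d] by (simp add: less_eq_div_iff_mult_less_eq)
      hence "real (2 * N div d) - 2 * real (N div d) \<ge> 0" by linarith
      from mult_left_mono[OF this mangoldt_nonneg[of d]] show ?thesis using False by simp
    qed
  qed
  also have "\<dots> = (\<Sum>d\<in>{0<..2*N}. mangoldt d * real (2 * N div d)) - 2 * (\<Sum>d\<in>{0<..2*N}. mangoldt d * real (N div d))"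
    by (simp add: sum_subtractf sum_distrib_left algebra_simps)
  also have "(\<Sum>d\<in>{0<..2*N}. mangoldt d * real (N div d)) = (\<Sum>d\<in>{0<..N}. mangoldt d * real (N div d))"
    by (intro sum.mono_neutral_right) auto
  also have "(\<Sum>d\<in>{0<..2*N}. mangoldt d * real (2 * N div d)) - 2 * (\<Sum>d\<in>{0<..N}. mangoldt d * real (N div d))
     = ln (fact (2 * N)) - 2 * ln (fact N)" by (simp add: ln_fact_conv_mangoldt)
  also have "\<dots> = ln (real (2 * N choose N))"
  proof -
    have "(fact (2 * N) :: real) = real (2 * N choose N) * (fact N * fact N)"
      using binomial_fact_lemma[of N "2 * N"]
      by (metis (no_types, lifting) add_diff_cancel_right' le_add2 mult.commute mult_2 of_nat_fact of_nat_mult)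
    thus ?thesis by (simp add: ln_mult)
  qed
  also have "\<dots> \<le> ln (2 ^ (2 * N))"
  proof -
    have "real (2 * N choose N) \<le> 2 ^ (2 * N)"
      using binomial_le_pow2[of "2 * N" N] of_nat_mono by fastforce
    thus ?thesis by (subst ln_le_cancel_iff) auto
  qed
  finally show ?thesis by (simp add: ln_realpow)
qed

text \<open>Induction through half of \<open>n\<close>, rounded up to \<open>m\<close>: the doubling
  step adds \<open>2 * m * ln 2\<close> to \<open>4 * m * ln 2\<close>, and
  \<open>6 * m \<le> 4 * n\<close> for \<open>n \<ge> 2\<close>. The constant 4 is what absorbs the
  rounding.\<close>

lemma chebyshev_psi_le: "chebyshev_psi n \<le> 4 * ln 2 * n"
proof (induction n rule: less_induct)
  case (less n)
  show ?case
  proof (cases "n \<ge> 2")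
    case False
    have "mangoldt k = (0::real)" if "k \<in> {0<..n}" for k
    proof -
      have "k = Suc 0" using False that by auto
      thus ?thesis by simp
    qed
    hence "chebyshev_psi n = 0" unfolding chebyshev_psi_def by (intro sum.neutral ballI)
    thus ?thesis by simp
  next
    case True
    define m where "m = (n + 1) div 2"
    have m: "m < n" "n \<le> 2 * m" "6 * m \<le> 4 * n" using True by (auto simp: m_def)
    have "chebyshev_psi n \<le> chebyshev_psi (2 * m)" using m by (intro chebyshev_psi_mono)
    also have "\<dots> \<le> 4 * ln 2 * m + 2 * m * ln 2"
      using chebyshev_psi_double[of m] less.IH[OF m(1)] by (simp add: algebra_simps)
    also have "\<dots> = ln 2 * real (6 * m)" by (simp add: algebra_simps)
    also have "\<dots> \<le> ln 2 * real (4 * n)" using m(3) by (intro mult_left_mono of_nat_mono) auto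
    finally show ?thesis by (simp add: mult_ac)
  qed
qed

section \<open>From Chebyshev's function to the prime counting function\<close>

lemma finite_primes_le: "finite {p::nat. prime p \<and> real p \<le> x}"
  by (rule finite_subset[of _ "{..nat \<lfloor>x\<rfloor>}"]) (auto simp: le_nat_floor)

text \<open>A prime \<open>p\<close> contributes \<open>ln p\<close> for each of its powers up to
  \<open>N\<close>; there are at most \<open>ln N / ln p\<close> of these, so its total share is at
  most \<open>ln N\<close>.\<close>

lemma chebyshev_psi_le_prime_pi:
  assumes N: "N > 0" shows "chebyshev_psi N \<le> prime_pi (real N) * ln N"
proof -
  define P where "P = {p::nat. prime p \<and> real p \<le> real N}"
  define K where "K = (\<lambda>p. {k. 0 < k \<and> p ^ k \<le> N})"
  have finP: "finite P" unfolding P_def by (rule finite_primes_le)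
  have K_le: "finite (K p) \<and> card (K p) * ln p \<le> ln N" if p: "p \<in> P" for p
  proof -
    have p2: "p \<ge> 2" using p by (auto simp: P_def prime_ge_2_nat)
    have "K p \<subseteq> {1..nat \<lfloor>ln N / ln p\<rfloor>}"
    proof
      fix k assume k: "k \<in> K p"
      have "real k * ln p = ln (real (p ^ k))" using p2 by (simp add: ln_realpow)
      also have "\<dots> \<le> ln N" using k N p2 by (subst ln_le_cancel_iff) (auto simp: K_def simp flip: of_nat_power)
      finally have "real k \<le> ln N / ln p" using p2 by (simp add: field_simps)
      thus "k \<in> {1..nat \<lfloor>ln N / ln p\<rfloor>}" using k by (auto simp: K_def le_nat_floor)
    qed
    hence fin: "finite (K p)" and "card (K p) \<le> nat \<lfloor>ln N / ln p\<rfloor>"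
      using finite_subset card_mono[of "{1..nat \<lfloor>ln N / ln p\<rfloor>}" "K p"] by auto
    moreover have "real (nat \<lfloor>ln N / ln p\<rfloor>) \<le> ln N / ln p"
      using N p2 by (intro of_nat_floor) auto
    ultimately have "real (card (K p)) \<le> ln N / ln p" by linarith
    thus ?thesis using p2 fin by (simp add: field_simps)
  qed
  have finT: "finite (Sigma P K)" using finP K_le by auto
  have "chebyshev_psi N = sum mangoldt {n\<in>{0<..N}. primepow n}"
    unfolding chebyshev_psi_def by (intro sum.mono_neutral_right) (auto simp: mangoldt_def)
  also have "\<dots> \<le> sum mangoldt ((\<lambda>(p, k). p ^ k) ` Sigma P K)"
  proof (rule sum_mono2)
    show "{n\<in>{0<..N}. primepow n} \<subseteq> (\<lambda>(p, k). p ^ k) ` Sigma P K"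
    proof
      fix n assume n: "n \<in> {n\<in>{0<..N}. primepow n}"
      then obtain p k where pk: "prime p" "k > 0" "n = p ^ k" by (auto simp: primepow_def)
      have "p \<le> n" using pk dvd_imp_le[of p n] n by auto
      hence "(p, k) \<in> Sigma P K" using n pk by (auto simp: P_def K_def)
      thus "n \<in> (\<lambda>(p, k). p ^ k) ` Sigma P K" using pk by force
    qed
  qed (use finT in \<open>auto simp: mangoldt_nonneg\<close>)
  also have "\<dots> \<le> sum (mangoldt \<circ> (\<lambda>(p, k). p ^ k)) (Sigma P K)"
    by (intro sum_image_le finT) (auto simp: mangoldt_nonneg)
  also have "\<dots> = (\<Sum>(p, k)\<in>Sigma P K. ln (real p))"
    by (intro sum.cong) (auto simp: P_def K_def)
  also have "\<dots> = (\<Sum>p\<in>P. \<Sum>k\<in>K p. ln (real p))"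
    using finP K_le by (subst sum.Sigma) auto
  also have "\<dots> \<le> (\<Sum>p\<in>P. ln (real N))"
    using K_le by (intro sum_mono) auto
  also have "\<dots> = prime_pi (real N) * ln N" by (simp add: prime_pi_def P_def)
  finally show ?thesis .
qed

lemma prime_pi_nat_floor: "x \<ge> 0 \<Longrightarrow> prime_pi x = prime_pi (real (nat \<lfloor>x\<rfloor>))"
proof -
  assume x: "x \<ge> 0"
  have "real p \<le> x \<longleftrightarrow> real p \<le> real (nat \<lfloor>x\<rfloor>)" for p
    using of_nat_mono[OF le_nat_floor[of p x], where ?'a = real] of_nat_floor[OF x] by linarith
  thus ?thesis by (simp add: prime_pi_def)
qed

text \<open>Primes between \<open>y\<close> and \<open>x\<close> weigh at least \<open>ln y\<close>
  each, and at most \<open>y\<close> primes are discarded. The free parameter \<open>y\<close> is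
  later a power of \<open>x\<close> with exponent slightly below 1.\<close>

lemma prime_pi_le_chebyshev_psi:
  assumes x: "x > 1" and y: "1 \<le> y" "y \<le> x"
  shows "ln y * (prime_pi x - y) \<le> chebyshev_psi (nat \<lfloor>x\<rfloor>)"
proof -
  let ?P = "\<lambda>x. {p::nat. prime p \<and> real p \<le> x}"
  have "card (?P y) \<le> card {1..nat \<lfloor>y\<rfloor>}"
    by (intro card_mono) (auto simp: le_nat_floor Suc_le_eq prime_gt_0_nat)
  also have "real \<dots> \<le> y" using y by (simp add: of_nat_floor)
  finally have "real (card (?P y)) \<le> y" by simp
  moreover have "card (?P x - ?P y) = card (?P x) - card (?P y)"
    using y finite_primes_le by (intro card_Diff_subset) auto
  moreover have "card (?P y) \<le> card (?P x)" using y finite_primes_le by (intro card_mono) auto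
  ultimately have c: "prime_pi x - y \<le> real (card (?P x - ?P y))" by (simp add: prime_pi_def of_nat_diff)
  have "ln y * (prime_pi x - y) \<le> ln y * real (card (?P x - ?P y))"
    using y c by (intro mult_left_mono) auto
  also have "\<dots> = (\<Sum>p\<in>?P x - ?P y. ln y)" by simp
  also have "\<dots> \<le> (\<Sum>p\<in>?P x - ?P y. mangoldt p)"
    using y by (intro sum_mono) auto
  also have "\<dots> \<le> chebyshev_psi (nat \<lfloor>x\<rfloor>)"
    unfolding chebyshev_psi_def
    by (intro sum_mono2) (auto simp: le_nat_floor prime_gt_0_nat mangoldt_nonneg)
  finally show ?thesis .
qed

lemma prime_pi_asymp_if_chebyshev_psi:
  assumes "(\<lambda>n. chebyshev_psi n / n) \<longlonglongrightarrow> 1"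
  shows "prime_pi \<sim>[at_top] (\<lambda>x. x / ln x)"
proof -
  define \<Psi> where "\<Psi> = (\<lambda>x::real. chebyshev_psi (nat \<lfloor>x\<rfloor>) / x)"
  have fl: "filterlim (\<lambda>x::real. nat \<lfloor>x\<rfloor>) sequentially at_top"
    by (rule filterlim_compose[OF filterlim_nat_sequentially filterlim_floor_sequentially])
  have "((\<lambda>x::real. chebyshev_psi (nat \<lfloor>x\<rfloor>) / nat \<lfloor>x\<rfloor> * (real (nat \<lfloor>x\<rfloor>) / x)) \<longlongrightarrow> 1 * 1) at_top"
  proof (rule tendsto_mult)
    show "((\<lambda>x::real. chebyshev_psi (nat \<lfloor>x\<rfloor>) / nat \<lfloor>x\<rfloor>) \<longlongrightarrow> 1) at_top"
      by (rule filterlim_compose[OF assms fl])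
    show "((\<lambda>x::real. real (nat \<lfloor>x\<rfloor>) / x) \<longlongrightarrow> 1) at_top" by real_asymp
  qed
  moreover have "eventually (\<lambda>x::real. chebyshev_psi (nat \<lfloor>x\<rfloor>) / nat \<lfloor>x\<rfloor> * (real (nat \<lfloor>x\<rfloor>) / x) = \<Psi> x) at_top"
    using eventually_ge_at_top[of 1] by eventually_elim (auto simp: \<Psi>_def chebyshev_psi_def)
  ultimately have \<Psi>: "(\<Psi> \<longlongrightarrow> 1) at_top" by (simp add: tendsto_cong)
  have "((\<lambda>x. prime_pi x / (x / ln x)) \<longlongrightarrow> 1) at_top"
  proof (rule order_tendstoI)
    fix a :: real assume a: "a < 1"
    have "eventually (\<lambda>x. \<Psi> x > a) at_top" using \<Psi> a by (rule order_tendstoD)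
    thus "eventually (\<lambda>x. a < prime_pi x / (x / ln x)) at_top"
      using eventually_gt_at_top[of 1]
    proof eventually_elim
      case (elim x)
      have N: "nat \<lfloor>x\<rfloor> > 0" using elim by simp
      have "chebyshev_psi (nat \<lfloor>x\<rfloor>) \<le> prime_pi x * ln (nat \<lfloor>x\<rfloor>)"
        using chebyshev_psi_le_prime_pi[OF N] elim prime_pi_nat_floor[of x] by simp
      also have "\<dots> \<le> prime_pi x * ln x"
        using elim N of_nat_floor[of x] by (intro mult_left_mono) (auto simp: prime_pi_def)
      finally have "\<Psi> x \<le> prime_pi x / (x / ln x)" using elim by (simp add: \<Psi>_def divide_right_mono)
      thus ?case using elim by simp
    qed
  next
    fix a :: real assume a: "a > 1"
    obtain b where b: "1 < b" "b < a" using dense[OF a] by blast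
    \<comment> \<open>With \<open>y = x powr (1 - \<epsilon>)\<close> the ratio
      \<open>ln x / ln y\<close> is exactly \<open>b < a\<close>, and the discarded primes cost only
      \<open>ln x * x powr (-\<epsilon>)\<close>, which tends to 0.\<close>
    define \<epsilon> where "\<epsilon> = 1 - 1 / b"
    have \<epsilon>: "0 < \<epsilon>" "\<epsilon> < 1" "1 - \<epsilon> = 1 / b" using b by (auto simp: \<epsilon>_def)
    have "((\<lambda>x. b * \<Psi> x + ln x * x powr (-\<epsilon>)) \<longlongrightarrow> b * 1 + 0) at_top"
    proof (intro tendsto_add tendsto_mult[OF tendsto_const \<Psi>])
      show "((\<lambda>x. ln x * x powr (-\<epsilon>)) \<longlongrightarrow> 0) at_top" using \<epsilon>(1) by real_asymp
    qed
    hence "eventually (\<lambda>x. b * \<Psi> x + ln x * x powr (-\<epsilon>) < a) at_top"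
      by (rule order_tendstoD) (use b in simp)
    thus "eventually (\<lambda>x. a > prime_pi x / (x / ln x)) at_top"
      using eventually_gt_at_top[of 1]
    proof eventually_elim
      case (elim x)
      define y where "y = x powr (1 - \<epsilon>)"
      have y: "1 \<le> y" "y \<le> x"
        using elim \<epsilon>(1,2) powr_mono[of "1 - \<epsilon>" 1 x] ge_one_powr_ge_zero[of x "1 - \<epsilon>"] by (auto simp: y_def)
      have ln_y: "ln y = ln x / b" using elim \<epsilon>(3) by (simp add: y_def ln_powr)
      have yx: "y / x = x powr (-\<epsilon>)"
        using elim powr_diff[of x "1 - \<epsilon>" 1] by (simp add: y_def)
      have "ln x * (prime_pi x - y) / b \<le> \<Psi> x * x"
        using prime_pi_le_chebyshev_psi[OF elim(2) y(1,2)] ln_y elim by (simp add: \<Psi>_def)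
      hence "prime_pi x * ln x \<le> b * \<Psi> x * x + ln x * y" using b by (simp add: field_simps)
      hence "prime_pi x * ln x / x \<le> (b * \<Psi> x * x + ln x * y) / x"
        using elim by (intro divide_right_mono) auto
      also have "\<dots> = b * \<Psi> x + ln x * (y / x)" using elim by (simp add: add_divide_distrib)
      finally show ?case using elim yx by simp
    qed
  qed
  thus ?thesis by (rule asymp_equivI')
qed

text \<open>If \<open>f x\<close> exceeds \<open>x\<close> by a fixed proportion, monotonicity keeps
  \<open>f n\<close> well above \<open>n\<close> on a whole block to the right of \<open>x\<close>;
  if it falls short, the same holds with signs reversed on a block to the left. Such a block of
  proportional length contributes a fixed amount to the sum, against the Cauchy criterion.\<close>

lemma mono_quotient_tendsto_1:
  fixes f :: "nat \<Rightarrow> real"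
  assumes mono: "mono f" and conv: "convergent (\<lambda>N. \<Sum>n\<in>{0<..N}. (f n / n - 1) / n)"
  shows "(\<lambda>n. f n / n) \<longlonglongrightarrow> 1"
proof -
  define g where "g = (\<lambda>n. (f n / n - 1) / n)"
  have cau: "\<exists>M. \<forall>x\<ge>M. \<forall>y\<ge>x. \<bar>\<Sum>n\<in>{x<..y}. g n\<bar> < \<epsilon>" if \<epsilon>: "\<epsilon> > 0" for \<epsilon>
  proof -
    have "Cauchy (\<lambda>N. \<Sum>n\<in>{0<..N}. g n)" using conv by (simp add: g_def Cauchy_convergent_iff)
    then obtain M where "\<forall>y\<ge>M. \<forall>x\<ge>M. \<bar>(\<Sum>n\<in>{0<..y}. g n) - (\<Sum>n\<in>{0<..x}. g n)\<bar> < \<epsilon>"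
      using \<epsilon> unfolding Cauchy_def dist_real_def by blast
    hence M: "\<bar>(\<Sum>n\<in>{0<..y}. g n) - (\<Sum>n\<in>{0<..x}. g n)\<bar> < \<epsilon>" if "x \<ge> M" "y \<ge> M" for x y
      using that by blast
    have "(\<Sum>n\<in>{0<..y}. g n) - (\<Sum>n\<in>{0<..x}. g n) = (\<Sum>n\<in>{x<..y}. g n)" if "x \<le> y" for x y
    proof -
      have "{0<..y} = {0<..x} \<union> {x<..y}" using that by auto
      thus ?thesis by (subst \<open>{0<..y} = _\<close>, subst sum.union_disjoint) auto
    qed
    thus ?thesis using M by (metis order_trans)
  qed
  have g_eq: "g n = (f n - n) / (real n)\<^sup>2" if "n > 0" for n
    using that by (simp add: g_def field_simps power2_eq_square)
  show ?thesis
  proof (rule order_tendstoI)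
    fix a :: real assume a: "a > 1"
    define \<eta> where "\<eta> = (a - 1) / 2"
    have \<eta>: "\<eta> > 0" "a = 1 + 2 * \<eta>" using a by (auto simp: \<eta>_def field_simps)
    \<comment> \<open>The block reaches from \<open>x\<close> to about
      \<open>(1 + \<eta>) * x\<close>. It has at least \<open>\<eta> * x / 2\<close> elements, since
      \<open>x \<ge> 2 / \<eta>\<close> makes rounding cost at most half, and each term is at least
      \<open>\<eta> / ((1 + \<eta>)^2 * x)\<close>; the product is
      \<open>\<epsilon>\<close>.\<close>
    define \<epsilon> where "\<epsilon> = \<eta>\<^sup>2 / (2 * (1 + \<eta>)\<^sup>2)"
    have "\<epsilon> > 0" using \<eta> by (auto simp: \<epsilon>_def)
    from cau[OF this] obtain M where M: "\<And>x y. x \<ge> M \<Longrightarrow> y \<ge> x \<Longrightarrow> \<bar>\<Sum>n\<in>{x<..y}. g n\<bar> < \<epsilon>" by metis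
    show "eventually (\<lambda>n. f n / n < a) sequentially"
      using eventually_ge_at_top[of M] eventually_gt_at_top[of "0::nat"] eventually_ge_at_top[of "nat \<lceil>2 / \<eta>\<rceil>"]
    proof eventually_elim
      case (elim x)
      show ?case
      proof (rule ccontr)
        assume "\<not> f x / x < a"
        hence fx: "f x \<ge> (1 + 2 * \<eta>) * x" using elim \<eta> by (simp add: field_simps)
        define y where "y = nat \<lfloor>(1 + \<eta>) * x\<rfloor>"
        have y: "real y \<le> (1 + \<eta>) * x" "real y > (1 + \<eta>) * x - 1"
          using \<eta> by (auto simp: y_def)
        have "real x \<le> (1 + \<eta>) * x" using \<eta> by (simp add: algebra_simps)
        hence xy: "x \<le> y" unfolding y_def by (simp add: le_nat_floor)
        have x2: "real x \<ge> 2 / \<eta>" using elim(3) by linarith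
        have g_ge: "g n \<ge> \<eta> / ((1 + \<eta>)\<^sup>2 * x)" if n: "n \<in> {x<..y}" for n
        proof -
          have n': "real n \<le> (1 + \<eta>) * x" using n y by (auto intro: order_trans[OF _ y(1)])
          have "\<eta> / ((1 + \<eta>)\<^sup>2 * x) = \<eta> * x / ((1 + \<eta>) * x)\<^sup>2"
            using elim(2) by (simp add: power2_eq_square)
          also have "\<dots> \<le> \<eta> * x / (real n)\<^sup>2"
            using n' n \<eta> elim(2) by (intro divide_left_mono power_mono mult_pos_pos zero_less_power) auto
          also have "\<dots> \<le> (f n - n) / (real n)\<^sup>2"
          proof (rule divide_right_mono)
            have "f n \<ge> f x" using n mono by (auto simp: mono_def)
            moreover have "(1 + 2 * \<eta>) * x = \<eta> * x + (1 + \<eta>) * x" by (simp add: algebra_simps)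
            ultimately show "\<eta> * x \<le> f n - n" using fx n' by linarith
          qed auto
          also have "\<dots> = g n" using n by (simp add: g_eq)
          finally show ?thesis .
        qed
        have "\<epsilon> = (\<eta> * x / 2) * (\<eta> / ((1 + \<eta>)\<^sup>2 * x))"
          using elim(2) by (simp add: \<epsilon>_def power2_eq_square)
        also have "\<dots> \<le> (real y - real x) * (\<eta> / ((1 + \<eta>)\<^sup>2 * x))"
        proof (rule mult_right_mono)
          have "\<eta> * x \<ge> 2" using x2 \<eta> by (simp add: field_simps)
          moreover have "(1 + \<eta>) * x = x + \<eta> * x" by (simp add: algebra_simps)
          ultimately show "\<eta> * x / 2 \<le> real y - real x" using y by linarith
        qed (use \<eta> in auto)
        also have "\<dots> = (\<Sum>n\<in>{x<..y}. \<eta> / ((1 + \<eta>)\<^sup>2 * x))" using xy by (simp add: of_nat_diff)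
        also have "\<dots> \<le> (\<Sum>n\<in>{x<..y}. g n)" by (rule sum_mono) (rule g_ge)
        finally show False using M[OF elim(1) xy] by linarith
      qed
    qed
  next
    fix a :: real assume a: "a < 1"
    \<comment> \<open>The cap keeps the block from \<open>(1 - \<eta>) * x\<close> to
      \<open>x\<close> on the positive side. Rounding its lower end down lengthens it, so it has at
      least \<open>\<eta> * x\<close> elements with terms at most \<open>- \<eta> / x\<close>, and
      no half is lost.\<close>
    define \<eta> where "\<eta> = min ((1 - a) / 2) (1 / 2)"
    have "\<eta> \<le> (1 - a) / 2" "\<eta> \<le> 1 / 2" "\<eta> > 0" using a unfolding \<eta>_def by (simp_all only: min.cobounded1 min.cobounded2) auto
    hence \<eta>: "\<eta> > 0" "\<eta> < 1" "a \<le> 1 - 2 * \<eta>" by auto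
    have "\<eta>\<^sup>2 > 0" using \<eta> by auto
    from cau[OF this] obtain M where M: "\<And>x y. x \<ge> M \<Longrightarrow> y \<ge> x \<Longrightarrow> \<bar>\<Sum>n\<in>{x<..y}. g n\<bar> < \<eta>\<^sup>2" by metis
    \<comment> \<open>The block now ends at \<open>x\<close>, so it is its lower end that has to lie
      beyond \<open>M\<close>.\<close>
    have fl: "filterlim (\<lambda>x. nat \<lfloor>(1 - \<eta>) * real x\<rfloor>) at_top sequentially"
      using \<eta>(2) by real_asymp
    show "eventually (\<lambda>n. a < f n / n) sequentially"
      using filterlim_at_top[THEN iffD1, OF fl, rule_format, of M] eventually_gt_at_top[of "0::nat"]
    proof eventually_elim
      case (elim x)
      define y where "y = nat \<lfloor>(1 - \<eta>) * real x\<rfloor>"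
      show ?case
      proof (rule ccontr)
        assume "\<not> a < f x / x"
        hence "f x \<le> a * x" using elim by (simp add: field_simps)
        also have "\<dots> \<le> (1 - 2 * \<eta>) * x" using \<eta> by (intro mult_right_mono) auto
        finally have fx: "f x \<le> (1 - 2 * \<eta>) * x" .
        have y: "real y \<le> (1 - \<eta>) * x" "real y > (1 - \<eta>) * x - 1"
          using \<eta> by (auto simp: y_def)
        have "(1 - \<eta>) * x \<le> x" using \<eta> by (simp add: algebra_simps)
        hence xy: "y \<le> x" using y(1) by linarith
        have g_le: "g n \<le> - \<eta> / x" if n: "n \<in> {y<..x}" for n
        proof -
          have "real n \<ge> real y + 1" using n by auto
          hence n': "real n \<ge> (1 - \<eta>) * x" using y(2) by linarith
          have "\<eta> / x = \<eta> * x / (real x)\<^sup>2" using elim(2) by (simp add: power2_eq_square)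
          also have "\<dots> \<le> \<eta> * x / (real n)\<^sup>2"
            using n \<eta> elim(2) by (intro divide_left_mono power_mono mult_pos_pos zero_less_power) auto
          also have "\<dots> \<le> (n - f n) / (real n)\<^sup>2"
          proof (rule divide_right_mono)
            have "f n \<le> f x" using n mono by (auto simp: mono_def)
            moreover have "(1 - 2 * \<eta>) * x = (1 - \<eta>) * x - \<eta> * x" by (simp add: algebra_simps)
            ultimately show "\<eta> * x \<le> n - f n" using fx n' by linarith
          qed auto
          also have "\<dots> = - g n" using n by (simp add: g_eq diff_divide_distrib)
          finally show ?thesis by simp
        qed
        have "(\<Sum>n\<in>{y<..x}. g n) \<le> (\<Sum>n\<in>{y<..x}. - \<eta> / x)" by (rule sum_mono) (rule g_le)
        also have "\<dots> = - ((real x - real y) * (\<eta> / x))" using xy by (simp add: of_nat_diff)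
        also have "\<dots> \<le> - ((\<eta> * x) * (\<eta> / x))"
        proof -
          have "(1 - \<eta>) * x = x - \<eta> * x" by (simp add: algebra_simps)
          hence "\<eta> * x \<le> real x - real y" using y by linarith
          thus ?thesis unfolding neg_le_iff_le using \<eta> by (intro mult_right_mono) auto
        qed
        also have "\<dots> = - (\<eta>\<^sup>2)" using elim(2) by (simp add: power2_eq_square)
        finally show False using M[OF _ xy] elim(1) unfolding y_def by fastforce
      qed
    qed
  qed
qed

text \<open>Partial summation expresses \<open>mangoldt_series\<close> by
  \<open>chebyshev_psi n\<close> times differences of consecutive powers; the boundary term vanishes
  by Chebyshev's bound. Replacing each difference by s n^(-s-1) costs exactly
  \<open>powr_step n s\<close>, and one factor \<open>n\<close> passes to the coefficient.\<close>

lemma chebyshev_psi_dirichlet_sums: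
  assumes s: "Re s > 1"
  shows "(\<lambda>n. of_real (chebyshev_psi n / n) * of_nat n powr (-s)) sums
     ((mangoldt_series s - (\<Sum>n. of_real (chebyshev_psi (Suc n)) * powr_step (Suc n) s)) / s)"
proof -
  let ?\<psi> = "\<lambda>n. complex_of_real (chebyshev_psi n)"
  define u where "u = (\<lambda>n. ?\<psi> (Suc n) * (of_nat (Suc n) powr (-s) - of_nat (Suc (Suc n)) powr (-s)))"
  have psi_Suc: "?\<psi> (Suc N) = ?\<psi> N + mangoldt (Suc N)" for N
  proof -
    have "{0<..Suc N} = insert (Suc N) {0<..N}" by auto
    hence "chebyshev_psi (Suc N) = chebyshev_psi N + mangoldt (Suc N)" by (simp add: chebyshev_psi_def)
    thus ?thesis by simp
  qed
  have part: "(\<Sum>n<N. u n) = (\<Sum>n<N. mangoldt (Suc n) * of_nat (Suc n) powr (-s)) - ?\<psi> N * of_nat (Suc N) powr (-s)" for N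
  proof (induction N)
    case (Suc N)
    show ?case unfolding sum.lessThan_Suc Suc.IH unfolding u_def psi_Suc by (simp only: algebra_simps)
  qed (simp add: chebyshev_psi_def)
  have "summable (\<lambda>n. norm (mangoldt n * of_nat n powr (-s) :: complex))"
    by (rule dirichlet_series_deriv(1)[OF summable_mangoldt_powr s])
  hence "(\<lambda>n. mangoldt n * of_nat n powr (-s)) sums mangoldt_series s"
    unfolding mangoldt_series_def by (simp add: summable_norm_cancel summable_sums)
  hence L: "(\<lambda>n. mangoldt (Suc n) * of_nat (Suc n) powr (-s)) sums mangoldt_series s"
    by (subst sums_Suc_iff) simp
  have Z: "(\<lambda>N. ?\<psi> N * of_nat (Suc N) powr (-s)) \<longlonglongrightarrow> 0"
  proof (rule Lim_null_comparison)
    show "eventually (\<lambda>N. norm (?\<psi> N * of_nat (Suc N) powr (-s)) \<le> 4 * ln 2 * real (Suc N) * real (Suc N) powr (- Re s)) sequentially"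
    proof (intro always_eventually allI)
      fix N
      have "chebyshev_psi N \<le> 4 * ln 2 * real (Suc N)"
        by (rule order_trans[OF chebyshev_psi_le]) (intro mult_left_mono, auto)
      thus "norm (?\<psi> N * of_nat (Suc N) powr (-s)) \<le> 4 * ln 2 * real (Suc N) * real (Suc N) powr (- Re s)"
        using chebyshev_psi_nonneg[of N]
        by (simp add: norm_mult norm_of_nat_powr mult_right_mono del: of_nat_Suc)
    qed
    show "(\<lambda>N. 4 * ln 2 * real (Suc N) * real (Suc N) powr (- Re s)) \<longlonglongrightarrow> 0"
      using s by real_asymp
  qed
  have U: "u sums mangoldt_series s"
    using tendsto_diff[OF L[unfolded sums_def] Z] unfolding sums_def part by simp
  let ?v = "\<lambda>n. ?\<psi> (Suc n) * powr_step (Suc n) s"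
  have "summable ?v"
  proof (rule holomorphic_series_powr_step(2))
    show "norm (?\<psi> n) \<le> (4 * ln 2) * real n powr 1" for n
      using chebyshev_psi_le[of n] chebyshev_psi_nonneg[of n] by simp
  qed (use s in auto)
  hence V: "?v sums (\<Sum>n. ?v n)" by (rule summable_sums)
  have s0: "s \<noteq> 0" using s by auto
  have "(\<lambda>n. (u n - ?v n) / s) sums ((mangoldt_series s - (\<Sum>n. ?v n)) / s)"
    by (intro sums_divide sums_diff U V)
  also have "(\<lambda>n. (u n - ?v n) / s) = (\<lambda>n. of_real (chebyshev_psi (Suc n) / real (Suc n)) * of_nat (Suc n) powr (-s))"
  proof
    fix n
    have "of_nat (Suc n) powr (-s - 1) = of_nat (Suc n) powr (-s) / complex_of_nat (Suc n)"
      by (subst powr_diff) (simp del: of_nat_Suc)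
    hence "u n - ?v n = s * (?\<psi> (Suc n) * (of_nat (Suc n) powr (-s) / of_nat (Suc n)))"
      unfolding u_def powr_step_def by (simp add: algebra_simps del: of_nat_Suc)
    thus "(u n - ?v n) / s = of_real (chebyshev_psi (Suc n) / real (Suc n)) * of_nat (Suc n) powr (-s)"
      using s0 by (simp del: of_nat_Suc)
  qed
  finally show ?thesis by (subst (asm) sums_Suc_iff) simp
qed

theorem prime_number_theorem: "prime_pi \<sim>[at_top] (\<lambda>x. x / ln x)"
proof (rule prime_pi_asymp_if_chebyshev_psi, rule mono_quotient_tendsto_1)
  show "mono chebyshev_psi" by (simp add: monoI chebyshev_psi_mono)
  define H where "H = (\<lambda>s. \<Sum>n. of_real (chebyshev_psi (Suc n)) * powr_step (Suc n) s)"
  \<comment> \<open>The poles at 1 of \<open>mangoldt_series s / s\<close> and of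
    \<open>zeta_sum s\<close> combine to \<open>q s / (s - 1)\<close>. Since \<open>q 1 = 0\<close>,
    this is the difference quotient \<open>G\<close>, whose singularity at 1 is removable.\<close>
  define q where "q = (\<lambda>s. 1 / s - zeta_reg s)"
  define G where "G = (\<lambda>s. if s = 1 then deriv q 1 else (q s - q 1) / (s - 1))"
  define F where "F = (\<lambda>s. (- (deriv zeta_reg s / zeta_reg s) - H s) / s + G s)"
  let ?S = "{s. Re s > 0}"
  define U where "U = ?S \<inter> zeta_reg -` (- {0})"
  have op: "open ?S" by (rule open_halfspace_Re_gt)
  have cont: "continuous_on ?S zeta_reg"
    by (rule holomorphic_on_imp_continuous_on[OF holomorphic_zeta_reg])
  have opU: "open U" unfolding U_def
    by (rule continuous_open_preimage[OF cont op]) auto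
  have psi_bound: "norm (complex_of_real (chebyshev_psi n)) \<le> (4 * ln 2) * real n powr 1" for n
    using chebyshev_psi_le[of n] chebyshev_psi_nonneg[of n] by simp
  have H: "H holomorphic_on ?S"
    unfolding H_def using holomorphic_series_powr_step(1)[OF psi_bound] by simp
  have "q holomorphic_on ?S" unfolding q_def
    by (intro holomorphic_intros holomorphic_zeta_reg) auto
  hence G: "G holomorphic_on ?S"
    unfolding G_def by (rule pole_lemma_open[OF _ op])
  have F: "F holomorphic_on U"
  proof -
    have "U \<subseteq> ?S" by (auto simp: U_def)
    note sub = holomorphic_on_subset[OF _ this]
    show ?thesis unfolding F_def
      by (intro holomorphic_on_add holomorphic_on_divide holomorphic_on_diff holomorphic_on_minus
            sub[OF H] sub[OF G] sub[OF holomorphic_zeta_reg]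
            sub[OF holomorphic_deriv[OF holomorphic_zeta_reg op]] holomorphic_on_ident)
         (auto simp: U_def)
  qed
  have sub: "{s. Re s \<ge> 1} \<subseteq> U"
  proof
    fix s assume s: "s \<in> {s. Re s \<ge> 1}"
    have "zeta_reg s \<noteq> 0"
    proof (cases "Re s = 1")
      case True thus ?thesis using zeta_reg_nonzero_line[of "Im s"] by (metis complex_surj)
    qed (use s zeta_reg_nonzero in auto)
    thus "s \<in> U" using s by (auto simp: U_def)
  qed
  have sums: "(\<lambda>n. of_real (chebyshev_psi n / n - 1) * of_nat n powr (-s)) sums F s" if s: "Re s > 1" for s
  proof -
    have "(\<lambda>n. of_nat n powr (-s)) sums zeta_sum s"
      unfolding zeta_sum_def using zeta_sum_deriv(1)[OF s] by (simp add: summable_norm_cancel summable_sums)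
    hence "(\<lambda>n. of_real (chebyshev_psi n / n) * of_nat n powr (-s) - of_nat n powr (-s)) sums
        ((mangoldt_series s - H s) / s - zeta_sum s)"
      unfolding H_def by (intro sums_diff chebyshev_psi_dirichlet_sums s)
    also have "(\<lambda>n. of_real (chebyshev_psi n / n) * of_nat n powr (-s) - of_nat n powr (-s)) =
        (\<lambda>n. complex_of_real (chebyshev_psi n / n - 1) * of_nat n powr (-s))"
      by (simp add: algebra_simps)
    also have "(mangoldt_series s - H s) / s - zeta_sum s = F s"
    proof -
      have ne: "s \<noteq> 1" "s \<noteq> 0" "s - 1 \<noteq> 0" using s by auto
      have M: "mangoldt_series s = 1 / (s - 1) - deriv zeta_reg s / zeta_reg s"
        using zeta_reg_logderiv[OF s] by simp
      have Z: "zeta_sum s = zeta_reg s / (s - 1)" using zeta_reg_eq[OF s] ne by simp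
      have "G s = 1 / (s - 1) / s - zeta_reg s / (s - 1)"
        using ne by (simp add: G_def q_def diff_divide_distrib mult.commute)
      thus ?thesis unfolding F_def M Z by (simp add: diff_divide_distrib)
    qed
    finally show ?thesis .
  qed
  have bnd: "norm (complex_of_real (chebyshev_psi n / n - 1)) \<le> 4 * ln 2 + 1" if "n > 0" for n
  proof -
    have "chebyshev_psi n / n \<le> 4 * ln 2" "chebyshev_psi n / n \<ge> 0"
      using chebyshev_psi_le[of n] chebyshev_psi_nonneg[of n] that by (auto simp: field_simps)
    thus ?thesis unfolding norm_of_real by linarith
  qed
  have "(\<lambda>N. Re (\<Sum>n\<in>{0<..N}. of_real (chebyshev_psi n / n - 1) / of_nat n)) \<longlonglongrightarrow> Re (F 1)"
    by (intro tendsto_Re newman_tauberian[OF bnd F opU sub sums])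
  also have "(\<lambda>N. Re (\<Sum>n\<in>{0<..N}. of_real (chebyshev_psi n / n - 1) / of_nat n)) =
      (\<lambda>N. \<Sum>n\<in>{0<..N}. (chebyshev_psi n / n - 1) / n)"
    by (intro ext) (simp add: Re_divide_of_nat)
  finally show "convergent (\<lambda>N. \<Sum>n\<in>{0<..N}. (chebyshev_psi n / n - 1) / n)"
    by (rule convergentI)
qed

section \<open>Change of variables and iterated inverses\<close>

lemma absolutely_integrable_on_iff_lebesgue_on:
  fixes f :: "real \<Rightarrow> real"
  assumes "S \<in> sets lebesgue"
  shows "f absolutely_integrable_on S \<longleftrightarrow> integrable (lebesgue_on S) f"
  using assms by (simp add: set_integrable_eq)

lemma lebesgue_on_change_of_variables:
  fixes u \<psi> w :: "real \<Rightarrow> real"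
  assumes S: "S \<in> sets lebesgue" and D: "\<psi> ` S \<in> sets lebesgue"
    and der: "\<And>x. x \<in> S \<Longrightarrow> (\<psi> has_real_derivative w x) (at x within S)"
    and w: "\<And>x. x \<in> S \<Longrightarrow> w x \<ge> 0" and inj: "inj_on \<psi> S"
    and u: "integrable (lebesgue_on (\<psi> ` S)) u"
  shows "integrable (lebesgue_on S) (\<lambda>t. u (\<psi> t) * w t)"
    and "(LINT t|lebesgue_on S. u (\<psi> t) * w t) = (LINT t|lebesgue_on (\<psi> ` S). u t)"
proof -
  have "u absolutely_integrable_on (\<psi> ` S) \<and> integral (\<psi> ` S) u = integral (\<psi> ` S) u"
    using u D by (simp add: absolutely_integrable_on_iff_lebesgue_on)
  with has_absolute_integral_change_of_variables_1'[OF S der inj, of u "integral (\<psi> ` S) u"]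
  have *: "(\<lambda>x. \<bar>w x\<bar> * u (\<psi> x)) absolutely_integrable_on S"
      "integral S (\<lambda>x. \<bar>w x\<bar> * u (\<psi> x)) = integral (\<psi> ` S) u"
    by blast+
  have "integrable (lebesgue_on S) (\<lambda>x. \<bar>w x\<bar> * u (\<psi> x))"
    using * S by (simp add: absolutely_integrable_on_iff_lebesgue_on)
  also have "?this \<longleftrightarrow> integrable (lebesgue_on S) (\<lambda>t. u (\<psi> t) * w t)"
    using w by (intro Bochner_Integration.integrable_cong) auto
  finally show int: "integrable (lebesgue_on S) (\<lambda>t. u (\<psi> t) * w t)" .
  have "(LINT t|lebesgue_on S. u (\<psi> t) * w t) = integral S (\<lambda>t. u (\<psi> t) * w t)"
    by (rule lebesgue_integral_eq_integral[OF int S])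
  also have "\<dots> = integral S (\<lambda>x. \<bar>w x\<bar> * u (\<psi> x))"
    using w by (intro integral_cong) auto
  also have "\<dots> = (LINT t|lebesgue_on (\<psi> ` S). u t)"
    unfolding *(2) by (rule lebesgue_integral_eq_integral[OF u D, symmetric])
  finally show "(LINT t|lebesgue_on S. u (\<psi> t) * w t) = (LINT t|lebesgue_on (\<psi> ` S). u t)" .
qed

lemma L2_on_mult_integrable:
  assumes "L2_on S f" "L2_on S g"
  shows "integrable (lebesgue_on S) (\<lambda>t. f t * g t)"
proof (rule Bochner_Integration.integrable_bound)
  show "integrable (lebesgue_on S) (\<lambda>t. (f t)\<^sup>2 + (g t)\<^sup>2)"
    using assms by (auto simp: L2_on_def)
  have [measurable]: "f \<in> borel_measurable (lebesgue_on S)" "g \<in> borel_measurable (lebesgue_on S)"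
    using assms by (auto simp: L2_on_def)
  show "(\<lambda>t. f t * g t) \<in> borel_measurable (lebesgue_on S)" by measurable
  have "\<bar>a * b\<bar> \<le> a\<^sup>2 + b\<^sup>2" for a b :: real
    using sum_squares_bound[of "\<bar>a\<bar>" "\<bar>b\<bar>"] mult_nonneg_nonneg[of "\<bar>a\<bar>" "\<bar>b\<bar>"]
    unfolding abs_mult power2_abs by linarith
  thus "AE t in lebesgue_on S. norm (f t * g t) \<le> norm ((f t)\<^sup>2 + (g t)\<^sup>2)" by simp
qed

text \<open>The preimage of a null set under \<open>\<psi>\<close> need not be null, since \<open>W\<close> may vanish;
  so the measurability of \<open>(f \<circ> \<psi>) W\<close> is recovered from that of \<open>(f \<circ> \<psi>) W\<^sup>2\<close> and \<open>W\<^sup>2\<close>.\<close>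

lemma L2_on_change_of_variables:
  fixes f \<psi> W :: "real \<Rightarrow> real"
  assumes S: "S \<in> sets lebesgue" and D: "\<psi> ` S \<in> lmeasurable"
    and der: "\<And>x. x \<in> S \<Longrightarrow> (\<psi> has_real_derivative (W x)\<^sup>2) (at x within S)"
    and W: "\<And>x. x \<in> S \<Longrightarrow> W x \<ge> 0" and inj: "inj_on \<psi> S"
    and f: "L2_on (\<psi> ` S) f"
  shows "L2_on S (\<lambda>t. f (\<psi> t) * W t)"
proof -
  have D': "\<psi> ` S \<in> sets lebesgue" using D by (simp add: fmeasurableD)
  have cov: "integrable (lebesgue_on S) (\<lambda>t. u (\<psi> t) * (W t)\<^sup>2)"
    if "integrable (lebesgue_on (\<psi> ` S)) u" for u
    by (rule lebesgue_on_change_of_variables(1)[OF S D' der zero_le_power2 inj that])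
  \<comment> \<open>The image has finite measure, so 1 is square integrable there and
    \<open>f\<close> itself is integrable. Thus \<open>cov\<close> applies to \<open>f\<close> and
    to 1 as well as to the square of \<open>f\<close>.\<close>
  have one: "integrable (lebesgue_on (\<psi> ` S)) (\<lambda>_. 1::real)"
    using D by (simp add: integrable_on_const lmeasurable_iff_integrable_on absolutely_integrable_on_iff_lebesgue_on[symmetric, OF D'])
  hence "L2_on (\<psi> ` S) (\<lambda>_. 1)" by (simp add: L2_on_def)
  from L2_on_mult_integrable[OF f this] have "integrable (lebesgue_on (\<psi> ` S)) f" by simp
  from cov[OF this] have [measurable]: "(\<lambda>t. f (\<psi> t) * (W t)\<^sup>2) \<in> borel_measurable (lebesgue_on S)"
    by (rule borel_measurable_integrable)
  from cov[OF one] have [measurable]: "(\<lambda>t. (W t)\<^sup>2) \<in> borel_measurable (lebesgue_on S)"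
    by (simp add: borel_measurable_integrable)
  \<comment> \<open>Where \<open>W t = 0\<close>, division by zero gives 0, which agrees with
    \<open>f (\<psi> t) * W t\<close>.\<close>
  have "(\<lambda>t. f (\<psi> t) * (W t)\<^sup>2 / sqrt ((W t)\<^sup>2)) \<in> borel_measurable (lebesgue_on S)" by measurable
  also have "?this \<longleftrightarrow> (\<lambda>t. f (\<psi> t) * W t) \<in> borel_measurable (lebesgue_on S)"
    using W by (intro measurable_cong) (auto simp: power2_eq_square)
  finally have meas: "(\<lambda>t. f (\<psi> t) * W t) \<in> borel_measurable (lebesgue_on S)" .
  have "integrable (lebesgue_on (\<psi> ` S)) (\<lambda>t. (f t)\<^sup>2)" using f by (simp add: L2_on_def)
  from cov[OF this] meas show ?thesis by (simp add: L2_on_def power_mult_distrib)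
qed

section \<open>Reverse iterates of the ladder and their asymptotics\<close>

lemma inv_into_half_line:
  fixes \<phi> :: "real \<Rightarrow> real"
  assumes mono: "strict_mono_on {t0..} \<phi>" and cont: "continuous_on {t0..} \<phi>"
    and top: "filterlim \<phi> at_top at_top"
  defines "g \<equiv> inv_into {t0..} \<phi>"
  shows "\<phi> ` {t0..} = {\<phi> t0..}"
    and "\<And>X. X \<ge> \<phi> t0 \<Longrightarrow> g X \<ge> t0 \<and> \<phi> (g X) = X"
    and "\<And>t. t \<ge> t0 \<Longrightarrow> g (\<phi> t) = t"
    and "\<And>X Y. \<phi> t0 \<le> X \<Longrightarrow> X \<le> Y \<Longrightarrow> g X \<le> g Y"
    and "filterlim g at_top at_top"
proof -
  have mono': "\<phi> x \<le> \<phi> y \<longleftrightarrow> x \<le> y" if "x \<ge> t0" "y \<ge> t0" for x y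
    using strict_mono_on_leD[OF mono, of x y] strict_mono_onD[OF mono, of y x] that by force
  show img: "\<phi> ` {t0..} = {\<phi> t0..}"
  proof
    show "\<phi> ` {t0..} \<subseteq> {\<phi> t0..}" using mono' by auto
    show "{\<phi> t0..} \<subseteq> \<phi> ` {t0..}"
    proof
      fix X assume X: "X \<in> {\<phi> t0..}"
      from top have "eventually (\<lambda>t. \<phi> t \<ge> X) at_top" by (simp add: filterlim_at_top)
      hence "eventually (\<lambda>t. \<phi> t \<ge> X \<and> t \<ge> t0) at_top" using eventually_ge_at_top by (rule eventually_conj)
      then obtain b where b: "\<phi> b \<ge> X" "b \<ge> t0" by (auto dest: eventually_happens)
      have "continuous_on {t0..b} \<phi>" by (rule continuous_on_subset[OF cont]) auto
      with IVT'[of \<phi> t0 X b] b X obtain x where "t0 \<le> x" "x \<le> b" "\<phi> x = X" by auto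
      thus "X \<in> \<phi> ` {t0..}" by auto
    qed
  qed
  show gX: "g X \<ge> t0 \<and> \<phi> (g X) = X" if "X \<ge> \<phi> t0" for X
  proof -
    have "X \<in> \<phi> ` {t0..}" using that img by auto
    thus ?thesis unfolding g_def using inv_into_into[of X \<phi> "{t0..}"] f_inv_into_f[of X \<phi> "{t0..}"] by auto
  qed
  show g_phi: "g (\<phi> t) = t" if "t \<ge> t0" for t
    unfolding g_def using that strict_mono_on_imp_inj_on[OF mono] by (intro inv_into_f_f) auto
  show g_mono: "g X \<le> g Y" if "\<phi> t0 \<le> X" "X \<le> Y" for X Y
    using gX[of X] gX[of Y] that mono'[of "g X" "g Y"] by auto
  show "filterlim g at_top at_top" unfolding filterlim_at_top
  proof
    fix Z
    define z where "z = max Z t0"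
    have "\<phi> t0 \<le> \<phi> z" using mono'[of t0 z] by (simp add: z_def)
    have "Z \<le> g X" if "X \<ge> \<phi> z" for X
      using g_mono[OF \<open>\<phi> t0 \<le> \<phi> z\<close> that] g_phi[of z] by (simp add: z_def)
    thus "eventually (\<lambda>X. Z \<le> g X) at_top" by (auto simp: eventually_at_top_linorder)
  qed
qed

text \<open>The claims are proved in one induction since each step uses the image and the order of
  the previous interval. The bound \<open>B\<close> dominates both \<open>t0\<close>, beyond which
  \<open>\<phi>\<close> is monotone and differentiable, and \<open>\<phi> t0\<close>, beyond which
  it can be inverted.\<close>

lemma funpow_inverse_ladder:
  fixes \<phi> Zt :: "real \<Rightarrow> real"
  assumes mono: "strict_mono_on {t0..} \<phi>"
    and der: "\<And>t. t \<ge> t0 \<Longrightarrow> (\<phi> has_real_derivative (Zt t)\<^sup>2) (at t)"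
    and top: "filterlim \<phi> at_top at_top"
  defines "g \<equiv> inv_into {t0..} \<phi>"
  assumes B: "B \<ge> t0" "B \<ge> \<phi> t0"
    and T: "T \<le> T'" "\<And>j X. j \<le> k \<Longrightarrow> X \<ge> T \<Longrightarrow> (g ^^ j) X \<ge> B"
  shows "(g ^^ k) T \<le> (g ^^ k) T'"
    and "(\<phi> ^^ k) ` {(g ^^ k) T..(g ^^ k) T'} = {T..T'}"
    and "inj_on (\<phi> ^^ k) {(g ^^ k) T..(g ^^ k) T'}"
    and "(\<phi> ^^ k) ((g ^^ k) T) = T"
    and "\<And>t. t \<in> {(g ^^ k) T..(g ^^ k) T'} \<Longrightarrow>
           ((\<phi> ^^ k) has_real_derivative (\<Prod>r<k. (Zt ((\<phi> ^^ r) t))\<^sup>2)) (at t)"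
proof -
  have "continuous_on {t0..} \<phi>"
    using der by (intro continuous_at_imp_continuous_on ballI DERIV_isCont) auto
  note g = inv_into_half_line[OF mono this top, folded g_def]
  let ?P = "\<lambda>k. (g ^^ k) T \<le> (g ^^ k) T' \<and> (\<phi> ^^ k) ` {(g ^^ k) T..(g ^^ k) T'} = {T..T'} \<and>
      inj_on (\<phi> ^^ k) {(g ^^ k) T..(g ^^ k) T'} \<and> (\<phi> ^^ k) ((g ^^ k) T) = T \<and>
      (\<forall>t \<in> {(g ^^ k) T..(g ^^ k) T'}. ((\<phi> ^^ k) has_real_derivative (\<Prod>r<k. (Zt ((\<phi> ^^ r) t))\<^sup>2)) (at t))"
  have "?P k" using T(2)
  proof (induction k)
    case 0
    show ?case using T(1) by (auto simp: DERIV_ident[unfolded id_def] id_def)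
  next
    case (Suc k)
    have IH: "?P k" using Suc.IH Suc.prems by auto
    define a b where "a = (g ^^ k) T" and "b = (g ^^ k) T'"
    have ab: "B \<le> a" "B \<le> b" "a \<le> b" using Suc.prems[of k] IH T(1) by (auto simp: a_def b_def)
    have ga: "g a \<ge> B" using Suc.prems[of "Suc k" T] by (simp add: a_def)
    have gab: "g a \<le> g b" using g(4)[of a b] ab B by auto
    have a': "\<phi> (g a) = a" and b': "\<phi> (g b) = b" using g(2) ab B by auto
    have mono': "\<phi> x \<le> \<phi> y \<longleftrightarrow> x \<le> y" if "x \<ge> t0" "y \<ge> t0" for x y
      using strict_mono_on_leD[OF mono, of x y] strict_mono_onD[OF mono, of y x] that by force
    have img: "\<phi> ` {g a..g b} = {a..b}"
    proof (intro equalityI subsetI)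
      fix X assume "X \<in> \<phi> ` {g a..g b}"
      then obtain t where t: "X = \<phi> t" "g a \<le> t" "t \<le> g b" by auto
      thus "X \<in> {a..b}" using mono'[of "g a" t] mono'[of t "g b"] a' b' ga B by auto
    next
      fix X assume X: "X \<in> {a..b}"
      have "\<phi> (g X) = X" "g X \<in> {g a..g b}" using g(2)[of X] g(4)[of a X] g(4)[of X b] X ab B by auto
      thus "X \<in> \<phi> ` {g a..g b}" by (metis image_eqI)
    qed
    have inj: "inj_on \<phi> {g a..g b}"
      by (rule inj_on_subset[OF strict_mono_on_imp_inj_on[OF mono]]) (use ga B in auto)
    \<comment> \<open>The new factor is applied first: \<open>\<phi>\<close> carries the interval of
      stage \<open>Suc k\<close> onto that of stage \<open>k\<close>, where the induction hypothesis
      holds.\<close>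
    have S: "\<phi> ^^ Suc k = (\<phi> ^^ k) \<circ> \<phi>" by (rule funpow_Suc_right)
    have gS: "(g ^^ Suc k) T = g a" "(g ^^ Suc k) T' = g b" by (simp_all add: a_def b_def)
    have IH': "(\<phi> ^^ k) ` {a..b} = {T..T'}" "inj_on (\<phi> ^^ k) {a..b}" "(\<phi> ^^ k) a = T"
      "\<And>t. t \<in> {a..b} \<Longrightarrow> ((\<phi> ^^ k) has_real_derivative (\<Prod>r<k. (Zt ((\<phi> ^^ r) t))\<^sup>2)) (at t)"
      using IH by (auto simp: a_def b_def)
    have "((\<phi> ^^ Suc k) has_real_derivative (\<Prod>r<Suc k. (Zt ((\<phi> ^^ r) t))\<^sup>2)) (at t)"
      if t: "t \<in> {g a..g b}" for t
    proof -
      have "\<phi> t \<in> {a..b}" using t img by blast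
      from DERIV_chain[OF IH'(4)[OF this] der] t ga B
      have "((\<phi> ^^ Suc k) has_real_derivative (\<Prod>r<k. (Zt ((\<phi> ^^ r) (\<phi> t)))\<^sup>2) * (Zt t)\<^sup>2) (at t)"
        unfolding S by auto
      moreover have "(\<Prod>r<k. (Zt ((\<phi> ^^ r) (\<phi> t)))\<^sup>2) * (Zt t)\<^sup>2 = (\<Prod>r<Suc k. (Zt ((\<phi> ^^ r) t))\<^sup>2)"
        unfolding prod.lessThan_Suc_shift by (simp add: funpow_swap1 mult.commute)
      ultimately show ?thesis by simp
    qed
    moreover have "(\<phi> ^^ Suc k) ` {g a..g b} = {T..T'}"
      unfolding S image_comp[symmetric] img IH'(1) ..
    moreover have "inj_on (\<phi> ^^ Suc k) {g a..g b}"
      unfolding S using inj IH'(2) by (intro comp_inj_on) (simp_all add: img)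
    moreover have "(\<phi> ^^ Suc k) (g a) = T" unfolding S by (simp add: a' IH'(3))
    ultimately show ?case unfolding gS using gab by blast
  qed
  thus "(g ^^ k) T \<le> (g ^^ k) T'"
    and "(\<phi> ^^ k) ` {(g ^^ k) T..(g ^^ k) T'} = {T..T'}"
    and "inj_on (\<phi> ^^ k) {(g ^^ k) T..(g ^^ k) T'}"
    and "(\<phi> ^^ k) ((g ^^ k) T) = T"
    and "\<And>t. t \<in> {(g ^^ k) T..(g ^^ k) T'} \<Longrightarrow>
           ((\<phi> ^^ k) has_real_derivative (\<Prod>r<k. (Zt ((\<phi> ^^ r) t))\<^sup>2)) (at t)"
    by blast+
qed

text \<open>Because \<open>ln (f T) = ln T + ln (f T / T)\<close> and the last term tends to 0, the
  scale \<open>T / ln T\<close> is unchanged, up to a factor tending to 1, when \<open>T\<close> is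
  replaced by \<open>f T\<close>.\<close>

lemma tendsto_quotient_1_imp:
  fixes f :: "real \<Rightarrow> real"
  assumes f: "((\<lambda>T. f T / T) \<longlongrightarrow> 1) at_top"
  shows "filterlim f at_top at_top"
    and "((\<lambda>T. (f T / ln (f T)) / (T / ln T)) \<longlongrightarrow> 1) at_top"
proof -
  have "filterlim (\<lambda>T. f T / T * T) at_top at_top"
    by (rule filterlim_tendsto_pos_mult_at_top[OF f _ filterlim_ident]) simp
  moreover have "eventually (\<lambda>T. f T / T * T = f T) at_top"
    using eventually_gt_at_top[of 0] by eventually_elim simp
  ultimately show top: "filterlim f at_top at_top" by (simp add: filterlim_cong)
  have "((\<lambda>T. 1 + ln (f T / T) * (1 / ln T)) \<longlongrightarrow> 1 + ln 1 * 0) at_top"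
  proof (intro tendsto_add tendsto_mult tendsto_const tendsto_ln f)
    show "((\<lambda>T::real. 1 / ln T) \<longlongrightarrow> 0) at_top" by real_asymp
  qed simp
  hence "((\<lambda>T. (f T / T) / (1 + ln (f T / T) * (1 / ln T))) \<longlongrightarrow> 1 / 1) at_top"
    by (intro tendsto_divide f) auto
  moreover have "eventually (\<lambda>T. (f T / T) / (1 + ln (f T / T) * (1 / ln T)) = (f T / ln (f T)) / (T / ln T)) at_top"
    using eventually_gt_at_top[of 1] filterlim_at_top_dense[THEN iffD1, OF top, rule_format, of 1]
  proof eventually_elim
    case (elim T)
    have "1 + ln (f T / T) * (1 / ln T) = ln (f T) / ln T"
      using elim by (simp add: ln_div field_simps)
    thus ?case using elim by (simp add: field_simps)
  qed
  ultimately show "((\<lambda>T. (f T / ln (f T)) / (T / ln T)) \<longlongrightarrow> 1) at_top"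
    by (simp add: tendsto_cong)
qed

text \<open>Inserting \<open>g X\<close> into the distance hypothesis turns its numerator into
  \<open>g X - X\<close>; as \<open>g X\<close> is asymptotic to \<open>X\<close>, the denominator
  may be changed to \<open>X / ln X\<close>. The function \<open>f\<close> allows the same limit at
  both endpoints of every iterated interval, always on the scale of \<open>T\<close>.\<close>

lemma right_inverse_distance:
  fixes \<phi> g :: "real \<Rightarrow> real"
  assumes g: "filterlim g at_top at_top" and inv: "eventually (\<lambda>X. \<phi> (g X) = X) at_top"
    and dist: "((\<lambda>T. (T - \<phi> T) / (T / ln T)) \<longlongrightarrow> c) at_top"
    and f: "((\<lambda>T. f T / T) \<longlongrightarrow> 1) at_top"
  shows "((\<lambda>T. (g (f T) - f T) / (T / ln T)) \<longlongrightarrow> c) at_top"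
proof -
  have "((\<lambda>T. 1 - (T - \<phi> T) / (T / ln T) * (1 / ln T)) \<longlongrightarrow> 1 - c * 0) at_top"
  proof (intro tendsto_diff tendsto_const tendsto_mult dist)
    show "((\<lambda>T::real. 1 / ln T) \<longlongrightarrow> 0) at_top" by real_asymp
  qed
  moreover have "eventually (\<lambda>T. 1 - (T - \<phi> T) / (T / ln T) * (1 / ln T) = \<phi> T / T) at_top"
    using eventually_gt_at_top[of 1] by eventually_elim (simp add: field_simps)
  ultimately have "((\<lambda>T. \<phi> T / T) \<longlongrightarrow> 1) at_top" by (simp add: tendsto_cong)
  hence "((\<lambda>X. \<phi> (g X) / g X) \<longlongrightarrow> 1) at_top" by (rule filterlim_compose[OF _ g])
  hence "((\<lambda>X. 1 / (\<phi> (g X) / g X)) \<longlongrightarrow> 1 / 1) at_top" by (intro tendsto_intros) auto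
  moreover have "eventually (\<lambda>X. 1 / (\<phi> (g X) / g X) = g X / X) at_top"
    using inv by eventually_elim simp
  ultimately have gX: "((\<lambda>X. g X / X) \<longlongrightarrow> 1) at_top"
    unfolding div_by_1 by (rule Lim_transform_eventually)
  have "((\<lambda>X. (g X - \<phi> (g X)) / (g X / ln (g X)) * ((g X / ln (g X)) / (X / ln X))) \<longlongrightarrow> c * 1) at_top"
    by (intro tendsto_mult filterlim_compose[OF dist g] tendsto_quotient_1_imp(2) gX)
  moreover have "eventually (\<lambda>X. (g X - \<phi> (g X)) / (g X / ln (g X)) * ((g X / ln (g X)) / (X / ln X)) = (g X - X) / (X / ln X)) at_top"
    using inv filterlim_at_top_dense[THEN iffD1, OF g, rule_format, of 1]
    by eventually_elim simp
  ultimately have h: "((\<lambda>X. (g X - X) / (X / ln X)) \<longlongrightarrow> c) at_top" by (simp add: tendsto_cong)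
  note ftop = tendsto_quotient_1_imp(1)[OF f]
  have "((\<lambda>T. (g (f T) - f T) / (f T / ln (f T)) * ((f T / ln (f T)) / (T / ln T))) \<longlongrightarrow> c * 1) at_top"
    by (intro tendsto_mult filterlim_compose[OF h ftop] tendsto_quotient_1_imp(2) f)
  moreover have "eventually (\<lambda>T. (g (f T) - f T) / (f T / ln (f T)) * ((f T / ln (f T)) / (T / ln T)) = (g (f T) - f T) / (T / ln T)) at_top"
    using filterlim_at_top_dense[THEN iffD1, OF ftop, rule_format, of 1]
    by eventually_elim simp
  ultimately show ?thesis by (simp add: tendsto_cong)
qed

text \<open>The induction also carries that both endpoints stay asymptotic to \<open>T\<close>; this
  is what makes the one-step limit applicable again.\<close>

lemma right_inverse_iterates_distance:
  fixes \<phi> g l :: "real \<Rightarrow> real"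
  assumes g: "filterlim g at_top at_top" and inv: "eventually (\<lambda>X. \<phi> (g X) = X) at_top"
    and dist: "((\<lambda>T. (T - \<phi> T) / (T / ln T)) \<longlongrightarrow> c) at_top"
    and l: "((\<lambda>T. l T / (T / ln T)) \<longlongrightarrow> 0) at_top"
  shows "((\<lambda>T. ((g ^^ k) (T + 2 * l T) - (g ^^ k) T) / (T / ln T)) \<longlongrightarrow> 0) at_top"
    and "((\<lambda>T. ((g ^^ Suc k) T - (g ^^ k) (T + 2 * l T)) / (T / ln T)) \<longlongrightarrow> c) at_top"
proof -
  note h = right_inverse_distance[OF g inv dist]
  have lnT: "((\<lambda>T::real. 1 / ln T) \<longlongrightarrow> 0) at_top" by real_asymp
  have step: "((\<lambda>T. g (f T) / T) \<longlongrightarrow> 1) at_top" if f: "((\<lambda>T. f T / T) \<longlongrightarrow> 1) at_top" for f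
  proof -
    have "((\<lambda>T. f T / T + (g (f T) - f T) / (T / ln T) * (1 / ln T)) \<longlongrightarrow> 1 + c * 0) at_top"
      by (intro tendsto_add tendsto_mult f h lnT)
    moreover have "eventually (\<lambda>T. f T / T + (g (f T) - f T) / (T / ln T) * (1 / ln T) = g (f T) / T) at_top"
      using eventually_gt_at_top[of 1] by eventually_elim (simp add: field_simps)
    ultimately show ?thesis by (simp add: tendsto_cong)
  qed
  have "((\<lambda>T. (g ^^ k) T / T) \<longlongrightarrow> 1) at_top \<and> ((\<lambda>T. (g ^^ k) (T + 2 * l T) / T) \<longlongrightarrow> 1) at_top
    \<and> ((\<lambda>T. ((g ^^ k) (T + 2 * l T) - (g ^^ k) T) / (T / ln T)) \<longlongrightarrow> 0) at_top" for k
  proof (induction k)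
    case 0
    have "((\<lambda>T. 2 * (l T / (T / ln T))) \<longlongrightarrow> 2 * 0) at_top" by (intro tendsto_mult tendsto_const l)
    hence 1: "((\<lambda>T. ((T + 2 * l T) - T) / (T / ln T)) \<longlongrightarrow> 0) at_top"
      by (simp add: mult.assoc)
    have "eventually (\<lambda>T::real. 1 = T / T) at_top"
      using eventually_gt_at_top[of 0] by eventually_elim simp
    hence 2: "((\<lambda>T::real. T / T) \<longlongrightarrow> 1) at_top" by (rule tendsto_eventually[OF eventually_mono]) simp
    have "((\<lambda>T. 1 + 2 * (l T / (T / ln T)) * (1 / ln T)) \<longlongrightarrow> 1 + 2 * 0 * 0) at_top"
      by (intro tendsto_add tendsto_mult tendsto_const l lnT)
    moreover have "eventually (\<lambda>T. 1 + 2 * (l T / (T / ln T)) * (1 / ln T) = (T + 2 * l T) / T) at_top"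
      using eventually_gt_at_top[of 1] by eventually_elim (simp add: field_simps)
    ultimately have 3: "((\<lambda>T. (T + 2 * l T) / T) \<longlongrightarrow> 1) at_top" by (simp add: tendsto_cong)
    show ?case using 1 2 3 by simp
  next
    case (Suc k)
    have X: "((\<lambda>T. (g ^^ k) T / T) \<longlongrightarrow> 1) at_top" and Y: "((\<lambda>T. (g ^^ k) (T + 2 * l T) / T) \<longlongrightarrow> 1) at_top"
      and D: "((\<lambda>T. ((g ^^ k) (T + 2 * l T) - (g ^^ k) T) / (T / ln T)) \<longlongrightarrow> 0) at_top"
      using Suc.IH by auto
    \<comment> \<open>New length = old length + displacement of the right end - displacement of the
      left end.\<close>
    have "((\<lambda>T. ((g ^^ k) (T + 2 * l T) - (g ^^ k) T) / (T / ln T)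
        + (g ((g ^^ k) (T + 2 * l T)) - (g ^^ k) (T + 2 * l T)) / (T / ln T)
        - (g ((g ^^ k) T) - (g ^^ k) T) / (T / ln T)) \<longlongrightarrow> 0 + c - c) at_top"
      by (intro tendsto_diff tendsto_add D h[OF X] h[OF Y])
    also have "(\<lambda>T. ((g ^^ k) (T + 2 * l T) - (g ^^ k) T) / (T / ln T)
        + (g ((g ^^ k) (T + 2 * l T)) - (g ^^ k) (T + 2 * l T)) / (T / ln T)
        - (g ((g ^^ k) T) - (g ^^ k) T) / (T / ln T)) =
        (\<lambda>T. ((g ^^ Suc k) (T + 2 * l T) - (g ^^ Suc k) T) / (T / ln T))"
      unfolding add_divide_distrib[symmetric] diff_divide_distrib[symmetric] by simp
    finally show ?case using step[OF X] step[OF Y] by simp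
  qed
  hence X: "((\<lambda>T. (g ^^ k) T / T) \<longlongrightarrow> 1) at_top"
    and D: "((\<lambda>T. ((g ^^ k) (T + 2 * l T) - (g ^^ k) T) / (T / ln T)) \<longlongrightarrow> 0) at_top" by auto
  from D show "((\<lambda>T. ((g ^^ k) (T + 2 * l T) - (g ^^ k) T) / (T / ln T)) \<longlongrightarrow> 0) at_top" .
  \<comment> \<open>The gap is the displacement of the left end minus the length of the interval it
    has to clear.\<close>
  have "((\<lambda>T. (g ((g ^^ k) T) - (g ^^ k) T) / (T / ln T)
      - ((g ^^ k) (T + 2 * l T) - (g ^^ k) T) / (T / ln T)) \<longlongrightarrow> c - 0) at_top"
    by (intro tendsto_diff h[OF X] D)
  also have "(\<lambda>T. (g ((g ^^ k) T) - (g ^^ k) T) / (T / ln T)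
      - ((g ^^ k) (T + 2 * l T) - (g ^^ k) T) / (T / ln T)) =
      (\<lambda>T. ((g ^^ Suc k) T - (g ^^ k) (T + 2 * l T)) / (T / ln T))"
    unfolding diff_divide_distrib[symmetric] by simp
  finally show "((\<lambda>T. ((g ^^ Suc k) T - (g ^^ k) (T + 2 * l T)) / (T / ln T)) \<longlongrightarrow> c) at_top" by simp
qed

section \<open>Orthogonal systems generated by Jacob's ladder\<close>

text \<open>The \<open>inj_on\<close> clause makes the continuum of systems precise: different
  \<open>T\<close> give different domains. The threshold \<open>T0\<close> is fixed before
  \<open>f\<close> and \<open>A\<close> and so is uniform in the given system.\<close>

theorem mainTheorem1:
  fixes \<mu> \<phi> \<phi>1 \<omega> Zt l :: "real \<Rightarrow> real" and t0 :: real and k0 :: nat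
  assumes mu_bound: "\<forall>\<^sub>F y in at_top. \<mu> y \<ge> 7 * y * ln y"
    and phi_solution: "\<forall>T\<ge>t0. \<phi> T > 0 \<and>
      (LINT t|lebesgue_on {0..\<mu> (\<phi> T)}. (hardy_Z t)\<^sup>2 * of_real (exp (- (2 / \<phi> T) * t)))
        = (LINT t|lebesgue_on {0..T}. (hardy_Z t)\<^sup>2)"
    and phi1_def: "\<phi>1 = (\<lambda>t. \<phi> t / 2)"
    and phi1_increasing: "strict_mono_on {t0..} \<phi>1"
    and phi1_at_top: "filterlim \<phi>1 at_top at_top"
    and phi1_distance: "(\<lambda>T. T - \<phi>1 T) \<sim>[at_top] (\<lambda>T. (1 - euler_mascheroni) * prime_pi T)"
    and phi1_deriv: "\<forall>t\<ge>t0. (\<phi>1 has_real_derivative (Zt t)\<^sup>2) (at t)"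
    and Zt_square: "\<forall>t\<ge>t0. (Zt t)\<^sup>2 = (cmod (riemann_zeta (Complex (1/2) t)))\<^sup>2 / \<omega> t"
    and omega_asymp: "(\<lambda>t. \<omega> t / ln t - 1) \<in> O[at_top](\<lambda>t. ln (ln t) / ln t)"
    and l_pos: "\<forall>\<^sub>F T in at_top. l T > 0"
    and l_small: "l \<in> o[at_top](\<lambda>T. T / ln T)"
  shows
    "(\<exists>T0.
        (\<forall>k\<in>{1..k0}. inj_on (\<lambda>T. {rev_iter t0 \<phi>1 k T..rev_iter t0 \<phi>1 k (T + 2 * l T)}) {T0..}) \<and>
        (\<forall>T\<ge>T0. \<forall>k\<in>{1..k0}. \<forall>f A.
           L2_orthogonal_system {0..2 * l T} A f \<longrightarrow>
             L2_orthogonal_system {rev_iter t0 \<phi>1 k T..rev_iter t0 \<phi>1 k (T + 2 * l T)} A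
               (ladder_system \<phi>1 Zt f T k) \<and>
             (\<forall>m\<ge>1. \<forall>n\<ge>1.
                (LINT t|lebesgue_on {rev_iter t0 \<phi>1 k T..rev_iter t0 \<phi>1 k (T + 2 * l T)}.
                   f m ((\<phi>1 ^^ k) t - T) * f n ((\<phi>1 ^^ k) t - T) * (\<Prod>r<k. (Zt ((\<phi>1 ^^ r) t))\<^sup>2))
                  = (if m = n then A n else 0))))
     \<and> (\<forall>k\<in>{1..k0}.
          (\<lambda>T. rev_iter t0 \<phi>1 k (T + 2 * l T) - rev_iter t0 \<phi>1 k T) \<in> o[at_top](\<lambda>T. T / ln T))
     \<and> (\<forall>k\<in>{1..k0}.
          (\<lambda>T. rev_iter t0 \<phi>1 k T - rev_iter t0 \<phi>1 (k - 1) (T + 2 * l T))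
            \<sim>[at_top] (\<lambda>T. (1 - euler_mascheroni) * prime_pi T))
     \<and> prime_pi \<sim>[at_top] (\<lambda>T. T / ln T)
     \<and> (\<forall>\<^sub>F T in at_top. \<forall>k\<in>{1..k0}.
          ivl_prec (rev_iter t0 \<phi>1 (k - 1) T, rev_iter t0 \<phi>1 (k - 1) (T + 2 * l T))
                   (rev_iter t0 \<phi>1 k T, rev_iter t0 \<phi>1 k (T + 2 * l T)))"
proof -
  define g where "g = inv_into {t0..} \<phi>1"
  define c :: real where "c = 1 - euler_mascheroni"
  \<comment> \<open>Positivity of 1 minus Euler's constant separates consecutive intervals and
    allows division by \<open>c\<close> in the asymptotics.\<close>
  have c: "c > 0" using euler_mascheroni_less_13_over_22 by (simp add: c_def)
  have rev: "rev_iter t0 \<phi>1 k X = (g ^^ k) X" for k X by (simp add: rev_iter_def g_def)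
  have der: "(\<phi>1 has_real_derivative (Zt t)\<^sup>2) (at t)" if "t \<ge> t0" for t
    using phi1_deriv that by blast
  have cont: "continuous_on {t0..} \<phi>1"
    using der by (intro continuous_at_imp_continuous_on ballI DERIV_isCont) auto
  note g = inv_into_half_line[OF phi1_increasing cont phi1_at_top, folded g_def]
  have inv: "eventually (\<lambda>X. \<phi>1 (g X) = X) at_top"
    using eventually_ge_at_top[of "\<phi>1 t0"] by eventually_elim (use g(2) in blast)
  have pi_equiv: "(\<lambda>T. c * (T / ln T)) \<sim>[at_top] (\<lambda>T. c * prime_pi T)"
    by (intro asymp_equiv_intros asymp_equiv_symI[OF prime_number_theorem])
  have dist: "((\<lambda>T. (T - \<phi>1 T) / (T / ln T)) \<longlongrightarrow> c) at_top"
  proof -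
    have nz: "eventually (\<lambda>T::real. T - \<phi>1 T \<noteq> 0 \<or> c * (T / ln T) \<noteq> 0) at_top"
      using eventually_gt_at_top[of 1] by eventually_elim (use c in auto)
    have "(\<lambda>T. T - \<phi>1 T) \<sim>[at_top] (\<lambda>T. c * (T / ln T))"
      using asymp_equiv_trans[OF phi1_distance[folded c_def] asymp_equiv_symI[OF pi_equiv]] .
    from asymp_equivD_strong[OF this nz]
    have "((\<lambda>T. c * ((T - \<phi>1 T) / (c * (T / ln T)))) \<longlongrightarrow> c * 1) at_top"
      by (intro tendsto_mult tendsto_const)
    thus ?thesis using c by simp
  qed
  note lim = right_inverse_iterates_distance[OF g(5) inv dist smalloD_tendsto[OF l_small]]
  have L_nz: "eventually (\<lambda>T::real. T / ln T \<noteq> 0) at_top"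
    using eventually_gt_at_top[of 1] by eventually_elim auto
  have gap: "(\<lambda>T. (g ^^ k) T - (g ^^ (k - 1)) (T + 2 * l T)) \<sim>[at_top] (\<lambda>T. c * prime_pi T)"
    if "k \<in> {1..k0}" for k
  proof -
    from that have "Suc (k - 1) = k" by simp
    from lim(2)[of "k - 1", unfolded this] have
      "(\<lambda>T. (g ^^ k) T - (g ^^ (k - 1)) (T + 2 * l T)) \<sim>[at_top] (\<lambda>T. c * (T / ln T))"
      using c by (intro asymp_equivI'_const) auto
    from asymp_equiv_trans[OF this pi_equiv] show ?thesis .
  qed
  have gap_pos: "eventually (\<lambda>T. \<forall>k\<in>{1..k0}. (g ^^ (k - 1)) (T + 2 * l T) < (g ^^ k) T) at_top"
  proof (intro eventually_ball_finite ballI)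
    fix k assume "k \<in> {1..k0}"
    hence "Suc (k - 1) = k" by simp
    from order_tendstoD(1)[OF lim(2)[of "k - 1", unfolded this] c]
    show "eventually (\<lambda>T. (g ^^ (k - 1)) (T + 2 * l T) < (g ^^ k) T) at_top"
      using eventually_gt_at_top[of 1] by eventually_elim (auto simp: zero_less_divide_iff zero_less_mult_iff)
  qed auto
  define B where "B = max t0 (\<phi>1 t0)"
  have g_top: "filterlim (g ^^ j) at_top at_top" for j
    by (induction j) (auto simp: id_def filterlim_ident o_def intro: filterlim_compose[OF g(5)])
  \<comment> \<open>Only finitely many iterates occur because \<open>k0\<close> is fixed, so one
    threshold serves all of them.\<close>
  have "eventually (\<lambda>T. l T > 0 \<and> (\<forall>j\<in>{..k0}. B \<le> (g ^^ j) T)) at_top"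
    using g_top by (intro eventually_conj l_pos eventually_ball_finite ballI) (auto simp: filterlim_at_top)
  then obtain T0 where T0: "\<And>T. T \<ge> T0 \<Longrightarrow> l T > 0" "\<And>T j. T \<ge> T0 \<Longrightarrow> j \<le> k0 \<Longrightarrow> B \<le> (g ^^ j) T"
    by (auto simp: eventually_at_top_linorder)
  have B: "B \<ge> t0" "B \<ge> \<phi>1 t0" by (auto simp: B_def)
  have lT: "T \<le> T + 2 * l T" if "T \<ge> T0" for T using T0(1)[OF that] by simp
  have ladder: "(g ^^ k) T \<le> (g ^^ k) (T + 2 * l T)"
      "(\<phi>1 ^^ k) ` {(g ^^ k) T..(g ^^ k) (T + 2 * l T)} = {T..T + 2 * l T}"
      "inj_on (\<phi>1 ^^ k) {(g ^^ k) T..(g ^^ k) (T + 2 * l T)}"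
      "(\<phi>1 ^^ k) ((g ^^ k) T) = T"
      "\<And>t. t \<in> {(g ^^ k) T..(g ^^ k) (T + 2 * l T)} \<Longrightarrow>
           ((\<phi>1 ^^ k) has_real_derivative (\<Prod>r<k. (Zt ((\<phi>1 ^^ r) t))\<^sup>2)) (at t)"
    if "T \<ge> T0" "k \<le> k0" for T k
  proof -
    have "B \<le> (g ^^ j) X" if "j \<le> k" "X \<ge> T" for j X
      using T0(2)[of X j] that \<open>T \<ge> T0\<close> \<open>k \<le> k0\<close> by simp
    note * = funpow_inverse_ladder[OF phi1_increasing der phi1_at_top B lT[OF that(1)], folded g_def, of k, OF _ this]
    show "(g ^^ k) T \<le> (g ^^ k) (T + 2 * l T)"
      "(\<phi>1 ^^ k) ` {(g ^^ k) T..(g ^^ k) (T + 2 * l T)} = {T..T + 2 * l T}"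
      "inj_on (\<phi>1 ^^ k) {(g ^^ k) T..(g ^^ k) (T + 2 * l T)}"
      "(\<phi>1 ^^ k) ((g ^^ k) T) = T"
      "\<And>t. t \<in> {(g ^^ k) T..(g ^^ k) (T + 2 * l T)} \<Longrightarrow>
           ((\<phi>1 ^^ k) has_real_derivative (\<Prod>r<k. (Zt ((\<phi>1 ^^ r) t))\<^sup>2)) (at t)"
      by (rule *; assumption)+
  qed
  have inj: "inj_on (\<lambda>T. {(g ^^ k) T..(g ^^ k) (T + 2 * l T)}) {T0..}" if "k \<in> {1..k0}" for k
  proof (rule inj_onI)
    fix T T' assume T: "T \<in> {T0..}" "T' \<in> {T0..}"
      and eq: "{(g ^^ k) T..(g ^^ k) (T + 2 * l T)} = {(g ^^ k) T'..(g ^^ k) (T' + 2 * l T')}"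
    \<comment> \<open>Both intervals are nonempty, so equal sets have equal left ends, from which
      \<open>\<phi>1 ^^ k\<close> recovers \<open>T\<close>.\<close>
    have "(g ^^ k) T = (g ^^ k) T'"
      using eq ladder(1)[of T k] ladder(1)[of T' k] T that unfolding Icc_eq_Icc by auto
    moreover have "(\<phi>1 ^^ k) ((g ^^ k) T) = T" "(\<phi>1 ^^ k) ((g ^^ k) T') = T'"
      using T that by (auto intro: ladder(4))
    ultimately show "T = T'" by metis
  qed
  have L2: "L2_orthogonal_system {(g ^^ k) T..(g ^^ k) (T + 2 * l T)} A (ladder_system \<phi>1 Zt f T k) \<and>
         (\<forall>m\<ge>1. \<forall>n\<ge>1.
            (LINT t|lebesgue_on {(g ^^ k) T..(g ^^ k) (T + 2 * l T)}.
               f m ((\<phi>1 ^^ k) t - T) * f n ((\<phi>1 ^^ k) t - T) * (\<Prod>r<k. (Zt ((\<phi>1 ^^ r) t))\<^sup>2))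
              = (if m = n then A n else 0))"
    if T: "T \<ge> T0" and k: "k \<in> {1..k0}" and f: "L2_orthogonal_system {0..2 * l T} A f" for T k f A
  proof -
    define S where "S = {(g ^^ k) T..(g ^^ k) (T + 2 * l T)}"
    define \<psi> where "\<psi> = (\<lambda>t. (\<phi>1 ^^ k) t - T)"
    \<comment> \<open>Each ladder function carries one factor \<open>W\<close>, so a product of two
      carries the square of \<open>W\<close>, which is the derivative of
      \<open>\<psi>\<close>.\<close>
    define W where "W = (\<lambda>t. \<Prod>r<k. \<bar>Zt ((\<phi>1 ^^ r) t)\<bar>)"
    have W2: "(W t)\<^sup>2 = (\<Prod>r<k. (Zt ((\<phi>1 ^^ r) t))\<^sup>2)" for t
      by (simp add: W_def prod_power_distrib)
    have W0: "W t \<ge> 0" for t unfolding W_def by (intro prod_nonneg) auto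
    have k': "k \<le> k0" using k by simp
    note lad = ladder[OF T k', folded S_def]
    have S: "S \<in> sets lebesgue" by (simp add: S_def)
    have img: "\<psi> ` S = {0..2 * l T}"
    proof -
      have "\<psi> ` S = (\<lambda>x. x - T) ` ((\<phi>1 ^^ k) ` S)" by (simp add: \<psi>_def image_image)
      thus ?thesis unfolding lad(2) by simp
    qed
    have der\<psi>: "(\<psi> has_real_derivative (W t)\<^sup>2) (at t within S)" if "t \<in> S" for t
      unfolding \<psi>_def W2 using DERIV_diff[OF lad(5)[OF that] DERIV_const[of T]]
      by (auto intro: has_field_derivative_at_within)
    have inj\<psi>: "inj_on \<psi> S" using lad(3) by (auto simp: \<psi>_def inj_on_def)
    have sys: "ladder_system \<phi>1 Zt f T k n = (\<lambda>t. f n (\<psi> t) * W t)" for n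
      by (simp add: ladder_system_def \<psi>_def W_def fun_eq_iff)
    have L2f: "L2_on (\<psi> ` S) (f n)" if "n \<ge> 1" for n
      using f that unfolding img L2_orthogonal_system_def by blast
    have int: "(LINT t|lebesgue_on S. (f m (\<psi> t) * f n (\<psi> t)) * (W t)\<^sup>2) = (if m = n then A n else 0)"
      if "m \<ge> 1" "n \<ge> 1" for m n
    proof -
      have "(LINT t|lebesgue_on S. (f m (\<psi> t) * f n (\<psi> t)) * (W t)\<^sup>2) = (LINT t|lebesgue_on (\<psi> ` S). f m t * f n t)"
        by (rule lebesgue_on_change_of_variables(2)[OF S _ der\<psi> _ inj\<psi> L2_on_mult_integrable[OF L2f L2f]])
           (use that in \<open>auto simp: img\<close>)
      thus ?thesis using f that unfolding img L2_orthogonal_system_def by simp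
    qed
    have "L2_on S (ladder_system \<phi>1 Zt f T k n)" if "n \<ge> 1" for n
      unfolding sys using that
      by (intro L2_on_change_of_variables[OF S _ der\<psi> W0 inj\<psi> L2f]) (auto simp: img)
    moreover have "(LINT t|lebesgue_on S. ladder_system \<phi>1 Zt f T k m t * ladder_system \<phi>1 Zt f T k n t)
        = (if m = n then A n else 0)" if "m \<ge> 1" "n \<ge> 1" for m n
      using int[OF that] by (simp add: sys power2_eq_square mult_ac)
    ultimately show ?thesis
      using int by (simp add: L2_orthogonal_system_def S_def \<psi>_def W2)
  qed
  have prec: "eventually (\<lambda>T. \<forall>k\<in>{1..k0}.
      ivl_prec ((g ^^ (k - 1)) T, (g ^^ (k - 1)) (T + 2 * l T)) ((g ^^ k) T, (g ^^ k) (T + 2 * l T))) at_top"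
    using gap_pos eventually_ge_at_top[of T0]
  proof eventually_elim
    case (elim T)
    show ?case
    proof
      fix k assume k: "k \<in> {1..k0}"
      hence "k - 1 \<le> k0" by auto
      thus "ivl_prec ((g ^^ (k - 1)) T, (g ^^ (k - 1)) (T + 2 * l T)) ((g ^^ k) T, (g ^^ k) (T + 2 * l T))"
        using k elim ladder(1)[OF elim(2), of k] ladder(1)[OF elim(2), of "k - 1"] by (simp add: ivl_prec_def)
    qed
  qed
  show ?thesis
    unfolding rev
  proof (intro conjI)
    show "\<exists>T0. (\<forall>k\<in>{1..k0}. inj_on (\<lambda>T. {(g ^^ k) T..(g ^^ k) (T + 2 * l T)}) {T0..}) \<and>
        (\<forall>T\<ge>T0. \<forall>k\<in>{1..k0}. \<forall>f A. L2_orthogonal_system {0..2 * l T} A f \<longrightarrow>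
             L2_orthogonal_system {(g ^^ k) T..(g ^^ k) (T + 2 * l T)} A (ladder_system \<phi>1 Zt f T k) \<and>
             (\<forall>m\<ge>1. \<forall>n\<ge>1.
                (LINT t|lebesgue_on {(g ^^ k) T..(g ^^ k) (T + 2 * l T)}.
                   f m ((\<phi>1 ^^ k) t - T) * f n ((\<phi>1 ^^ k) t - T) * (\<Prod>r<k. (Zt ((\<phi>1 ^^ r) t))\<^sup>2))
                  = (if m = n then A n else 0)))"
      using inj L2 by (intro exI[of _ T0] conjI ballI allI impI) blast+
    show "\<forall>k\<in>{1..k0}. (\<lambda>T. (g ^^ k) (T + 2 * l T) - (g ^^ k) T) \<in> o(\<lambda>T. T / ln T)"
      using lim(1) L_nz by (intro ballI smalloI_tendsto) auto
    show "\<forall>k\<in>{1..k0}. (\<lambda>T. (g ^^ k) T - (g ^^ (k - 1)) (T + 2 * l T)) \<sim>[at_top] (\<lambda>T. (1 - euler_mascheroni) * prime_pi T)"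
      using gap by (simp add: c_def)
  qed (use prime_number_theorem prec in auto)
qed

end
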